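(* The following statements are equivalent for any finite graph $G$. (1) $\chi_c(G)<3$. (2) $G\in\mathrm{CSP}(\mathbb C_3)$. (3) $G$ can be extended to a $\{K_3,\ K_1+2K_2,\ K_1+C_5,\ C_6\}$-free graph. (4) $G$ can be extended to a maximal triangle-free graph that is $\{K_1+2K_2,\ K_1+C_5,\ C_6\}$-free. (5) $G$ can be extended to a maximal triangle-free graph that does not contain $H_{10}-v$ as a subgraph. (6) $\overline G$ contains a spanning $3K_1$-free unit Helly circular-arc subgraph.
   Context: Graphs are simple, undirected, with non-empty vertex set. For $r\in\mathbb R^+$, a circular $r$-colouring of $G$ is a function $f$ from $V(G)$ to a circle of circumference $1$ such that for every edge $xy$ both circular arcs defined by $f(x)$ and $f(y)$ have length at least $1/r$; $\chi_c(G)=\inf\{r : G \text{ has a circular } r\text{-colouring}\}$. $\mathbb C_3$: the vertex set is a countable dense subset of the unit circle $S^1$ such that any two distinct points of it lie at a rational angle (in radians, hence never exactly $2\pi/3$), and $xy$ is an edge iff both circular arcs with end-points $x,y$ have length strictly larger than $1/3$ of the circumference (any such choice gives the same graph up to isomorphism). $G\in\mathrm{CSP}(\mathbb C_3)$ means that $G$ is finite and there is a homomorphism (edge-preserving map) $G\to\mathbb C_3$. "$G$ can be extended to $G'$" means $V(G')=V(G)$ and $E(G)\subseteq E(G')$ (possibly $G'=G$). A graph is maximal triangle-free if it is triangle-free and no proper supergraph on the same vertex set is triangle-free. $\mathcal F$-free means containing no member of $\mathcal F$ as an induced subgraph; "subgraph" means not necessarily induced. $G+H$ is disjoint union, $2K_2=K_2+K_2$,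 $3K_1$ is the edgeless graph on three vertices, $\overline G$ is the complement. $H_{10}$ is the Petersen graph and $H_{10}-v$ is the Petersen graph minus one vertex. A circular-arc model of a graph is a pair $(C,\mathcal A)$ with $C$ a circle and $\mathcal A$ a set of circular-arcs of $C$ whose intersection graph is isomorphic to the graph. It is unit if all arcs have unit length, and Helly if every pairwise intersecting subset of $\mathcal A$ has non-empty total intersection. A unit Helly circular-arc graph is one admitting a circular-arc model that is both unit and Helly. A spanning subgraph is a subgraph with the same vertex set. *)

theory Defs
  imports "HOL-Analysis.Analysis"
begin

section \<open>Graphs\<close>

record 'a graph =
  verts :: "'a set"
  edges :: "'a set set"

definition is_graph :: "'a graph \<Rightarrow> bool" where
  "is_graph G \<longleftrightarrow> verts G \<noteq> {} \<and>
     (\<forall>e\<in>edges G. \<exists>x\<in>verts G. \<exists>y\<in>verts G. x \<noteq> y \<and> e = {x, y})"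

definition finite_graph :: "'a graph \<Rightarrow> bool" where
  "finite_graph G \<longleftrightarrow> is_graph G \<and> finite (verts G)"

definition isomorphic :: "'a graph \<Rightarrow> 'b graph \<Rightarrow> bool" where
  "isomorphic G H \<longleftrightarrow> (\<exists>f. bij_betw f (verts G) (verts H) \<and>
     (\<forall>x\<in>verts G. \<forall>y\<in>verts G. {x, y} \<in> edges G \<longleftrightarrow> {f x, f y} \<in> edges H))"

definition homomorphism :: "('a \<Rightarrow> 'b) \<Rightarrow> 'a graph \<Rightarrow> 'b graph \<Rightarrow> bool" where
  "homomorphism f G H \<longleftrightarrow> f ` verts G \<subseteq> verts H \<and>
     (\<forall>x y. {x, y} \<in> edges G \<longrightarrow> {f x, f y} \<in> edges H)"

definition CSP :: "'b graph \<Rightarrow> 'a graph set" where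
  "CSP H = {G. finite_graph G \<and> (\<exists>f. homomorphism f G H)}"

definition subgraph :: "'a graph \<Rightarrow> 'a graph \<Rightarrow> bool" where
  "subgraph S G \<longleftrightarrow> is_graph S \<and> verts S \<subseteq> verts G \<and> edges S \<subseteq> edges G"

definition spanning_subgraph :: "'a graph \<Rightarrow> 'a graph \<Rightarrow> bool" where
  "spanning_subgraph S G \<longleftrightarrow> subgraph S G \<and> verts S = verts G"

definition induced :: "'a graph \<Rightarrow> 'a set \<Rightarrow> 'a graph" where
  "induced G W = \<lparr>verts = W, edges = {e \<in> edges G. e \<subseteq> W}\<rparr>"

definition delete_vertex :: "'a graph \<Rightarrow> 'a \<Rightarrow> 'a graph" where
  "delete_vertex G v = induced G (verts G - {v})"

definition complement :: "'a graph \<Rightarrow> 'a graph" where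
  "complement G = \<lparr>verts = verts G,
     edges = {{x, y} | x y. x \<in> verts G \<and> y \<in> verts G \<and> x \<noteq> y \<and> {x, y} \<notin> edges G}\<rparr>"

definition contains_subgraph :: "'a graph \<Rightarrow> 'b graph \<Rightarrow> bool" where
  "contains_subgraph G H \<longleftrightarrow> (\<exists>S. subgraph S G \<and> isomorphic S H)"

text \<open>\<open>free_of H G\<close>: the graph \<open>G\<close> is \<open>H\<close>-free, for induced subgraphs.\<close>

definition free_of :: "'b graph \<Rightarrow> 'a graph \<Rightarrow> bool" where
  "free_of H G \<longleftrightarrow> \<not> (\<exists>W\<subseteq>verts G. isomorphic (induced G W) H)"

definition extends_to :: "'a graph \<Rightarrow> 'a graph \<Rightarrow> bool" where
  "extends_to G G' \<longleftrightarrow> is_graph G' \<and> verts G' = verts G \<and> edges G \<subseteq> edges G'"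


subsection \<open>Particular graphs\<close>

definition complete_graph :: "nat \<Rightarrow> nat graph" where
  "complete_graph n = \<lparr>verts = {..<n}, edges = {{i, j} | i j. i < n \<and> j < n \<and> i \<noteq> j}\<rparr>"

definition edgeless_graph :: "nat \<Rightarrow> nat graph" where
  "edgeless_graph n = \<lparr>verts = {..<n}, edges = {}\<rparr>"

text \<open>Only meaningful for \<open>n \<ge> 3\<close>.\<close>

definition cycle_graph :: "nat \<Rightarrow> nat graph" where
  "cycle_graph n = \<lparr>verts = {..<n}, edges = {{i, (i + 1) mod n} | i. i < n}\<rparr>"

definition disjoint_union :: "'a graph \<Rightarrow> 'b graph \<Rightarrow> ('a + 'b) graph" where
  "disjoint_union G H = \<lparr>verts = verts G <+> verts H,
     edges = (\<lambda>e. Inl ` e) ` edges G \<union> (\<lambda>e. Inr ` e) ` edges H\<rparr>"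

abbreviation "K\<^sub>1 \<equiv> complete_graph 1"
abbreviation "K\<^sub>2 \<equiv> complete_graph 2"
abbreviation "K\<^sub>3 \<equiv> complete_graph 3"
abbreviation "C\<^sub>5 \<equiv> cycle_graph 5"
abbreviation "C\<^sub>6 \<equiv> cycle_graph 6"
abbreviation "K1_plus_2K2 \<equiv> disjoint_union K\<^sub>1 (disjoint_union K\<^sub>2 K\<^sub>2)"
abbreviation "K1_plus_C5 \<equiv> disjoint_union K\<^sub>1 C\<^sub>5"

text \<open>The Petersen graph as the Kneser graph on the 2-subsets of a 5-set. It is
  vertex-transitive, so the choice of the deleted vertex is immaterial.\<close>

definition petersen :: "nat set graph" where
  "petersen = (let V = {A. A \<subseteq> {..<5} \<and> card A = 2} in
     \<lparr>verts = V, edges = {{A, B} | A B. A \<in> V \<and> B \<in> V \<and> A \<inter> B = {}}\<rparr>)"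

definition petersen_minus_vertex :: "nat set graph" where
  "petersen_minus_vertex = delete_vertex petersen {0, 1}"

definition maximal_triangle_free :: "'a graph \<Rightarrow> bool" where
  "maximal_triangle_free G \<longleftrightarrow> is_graph G \<and> free_of K\<^sub>3 G \<and>
     (\<forall>G'. extends_to G G' \<and> edges G' \<noteq> edges G \<longrightarrow> \<not> free_of K\<^sub>3 G')"


section \<open>Arcs on circles\<close>

text \<open>Circles are centred at the origin of the complex plane. For \<open>x\<close>, \<open>y\<close> on the same circle,
  \<open>arc_length x y\<close> is the length of the arc running counterclockwise from \<open>x\<close> to \<open>y\<close>, so for
  \<open>x \<noteq> y\<close> the two arcs with end-points \<open>x\<close>, \<open>y\<close> have lengths \<open>arc_length x y\<close> and
  \<open>arc_length y x\<close>; both are \<open>0\<close> if \<open>x = y\<close>.\<close>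

definition arc_length :: "complex \<Rightarrow> complex \<Rightarrow> real" where
  "arc_length x y = cmod x * Arg2pi (y / x)"

definition circular_arc :: "complex \<Rightarrow> complex \<Rightarrow> complex set" where
  "circular_arc x y = {z \<in> sphere 0 (cmod x). arc_length x z \<le> arc_length x y}"


subsection \<open>Circular chromatic number\<close>

text \<open>The circle of circumference \<open>1\<close> has radius \<open>1 / (2 * pi)\<close>.\<close>

definition circular_colouring :: "real \<Rightarrow> ('a \<Rightarrow> complex) \<Rightarrow> 'a graph \<Rightarrow> bool" where
  "circular_colouring r f G \<longleftrightarrow> f ` verts G \<subseteq> sphere 0 (1 / (2 * pi)) \<and>
     (\<forall>x y. {x, y} \<in> edges G \<longrightarrow> arc_length (f x) (f y) \<ge> 1 / r \<and> arc_length (f y) (f x) \<ge> 1 / r)"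

text \<open>For a finite graph the set below is nonempty (spread the vertices evenly), so the
  infimum in the reals is the intended one.\<close>

definition circular_chromatic_number :: "'a graph \<Rightarrow> real" (\<open>\<chi>\<^sub>c\<close>) where
  "\<chi>\<^sub>c G = Inf {r. r > 0 \<and> (\<exists>f. circular_colouring r f G)}"


subsection \<open>The graph \<open>\<complex>\<^sub>3\<close>\<close>

text \<open>The angle is taken modulo \<open>2 * pi\<close>: three points of a dense set whose arcs add up to the
  whole circle cannot have all three arcs rational, so a rational angle can only mean that one
  point is obtained from the other by a rotation through a rational angle.\<close>

definition C3_points :: "complex set \<Rightarrow> bool" where
  "C3_points D \<longleftrightarrow> D \<subseteq> sphere 0 1 \<and> countable D \<and> sphere 0 1 \<subseteq> closure D \<and>
     (\<forall>x\<in>D. \<forall>y\<in>D. x \<noteq> y \<longrightarrow> (\<exists>q\<in>\<rat>. y = x * cis q))"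

definition C3_graph :: "complex set \<Rightarrow> complex graph" where
  "C3_graph D = \<lparr>verts = D, edges = {{x, y} | x y. x \<in> D \<and> y \<in> D \<and>
     arc_length x y > (2 * pi) / 3 \<and> arc_length y x > (2 * pi) / 3}\<rparr>"

lemma C3_points_cis_Rats: "C3_points (cis ` \<rat>)"
  unfolding C3_points_def
proof (intro conjI ballI impI)
  show "cis ` \<rat> \<subseteq> sphere 0 1" by auto
  show "countable (cis ` \<rat>)" by (intro countable_image countable_rat)
  show "sphere 0 1 \<subseteq> closure (cis ` \<rat>)"
  proof
    fix z :: complex assume "z \<in> sphere 0 1"
    then have "cmod z = 1" by simp
    then have "z = cis (Arg z)"
      using rcis_cmod_Arg[of z] by (simp add: rcis_def)
    moreover have "cis ` closure \<rat> \<subseteq> closure (cis ` \<rat>)"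
      by (intro image_closure_subset closure_subset closed_closure continuous_intros)
    ultimately show "z \<in> closure (cis ` \<rat>)"
      unfolding Rats_closure_real by (metis UNIV_I image_subset_iff)
  qed
next
  fix x y assume "x \<in> cis ` \<rat>" "y \<in> cis ` \<rat>" "x \<noteq> y"
  then obtain p q where pq: "p \<in> \<rat>" "q \<in> \<rat>" "x = cis p" "y = cis q" by auto
  then have "q - p \<in> \<rat>" "y = x * cis (q - p)" by (auto simp: cis_mult)
  then show "\<exists>q\<in>\<rat>. y = x * cis q" by blast
qed


subsection \<open>Circular-arc graphs\<close>

definition intersection_graph :: "'p set set \<Rightarrow> 'p set graph" where
  "intersection_graph \<A> = \<lparr>verts = \<A>,
     edges = {{a, b} | a b. a \<in> \<A> \<and> b \<in> \<A> \<and> a \<noteq> b \<and> a \<inter> b \<noteq> {}}\<rparr>"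

text \<open>A model is given by the radius \<open>\<rho>\<close> of its circle together with a set of (closed) arcs.\<close>

definition circular_arc_model :: "real \<Rightarrow> complex set set \<Rightarrow> 'a graph \<Rightarrow> bool" where
  "circular_arc_model \<rho> \<A> G \<longleftrightarrow> \<rho> > 0 \<and>
     (\<forall>a\<in>\<A>. \<exists>x\<in>sphere 0 \<rho>. \<exists>y\<in>sphere 0 \<rho>. a = circular_arc x y) \<and>
     isomorphic (intersection_graph \<A>) G"

definition unit_model :: "real \<Rightarrow> complex set set \<Rightarrow> bool" where
  "unit_model \<rho> \<A> \<longleftrightarrow>
     (\<forall>a\<in>\<A>. \<exists>x\<in>sphere 0 \<rho>. \<exists>y\<in>sphere 0 \<rho>. a = circular_arc x y \<and> arc_length x y = 1)"

definition Helly :: "'p set set \<Rightarrow> bool" where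
  "Helly \<A> \<longleftrightarrow> (\<forall>\<B>\<subseteq>\<A>. \<B> \<noteq> {} \<and> (\<forall>a\<in>\<B>. \<forall>b\<in>\<B>. a \<inter> b \<noteq> {}) \<longrightarrow> \<Inter>\<B> \<noteq> {})"

definition unit_Helly_circular_arc_graph :: "'a graph \<Rightarrow> bool" where
  "unit_Helly_circular_arc_graph G \<longleftrightarrow>
     (\<exists>\<rho> \<A>. circular_arc_model \<rho> \<A> G \<and> unit_model \<rho> \<A> \<and> Helly \<A>)"

end

theory Submission
  imports Defs
begin

text \<open>All six conditions are compared with one finite, arithmetical condition: for some
  \<open>k \<ge> 1\<close> the vertices can be coloured by residues modulo \<open>3 * k - 1\<close> so that the colours of
  adjacent vertices are at cyclic distance at least \<open>k\<close>. This is a homomorphism to the \<open>k\<close>-th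
  Andrasfai graph, which is also the circular complete graph with parameters \<open>3 * k - 1\<close> and \<open>k\<close>.

  The chromatic number and \<open>\<complex>\<^sub>3\<close>. A colouring as above is a circular \<open>(3 * k - 1) / k\<close>-colouring, and
  \<open>(3 * k - 1) / k < 3\<close>. In the other direction, both \<open>\<chi>\<^sub>c G < 3\<close> and a homomorphism to \<open>\<complex>\<^sub>3\<close> place the
  vertices on a circle of circumference 1 with adjacent vertices more than \<open>1 / 3\<close> apart. There are
  finitely many edges, so there is some slack, and the positions can be rounded down to multiples of
  \<open>1 / (3 * k - 1)\<close> for a large \<open>k\<close> (\<open>andrasfai_colouring_if_angles\<close>). Points of a dense set that
  approximate the multiples of \<open>1 / (3 * k - 1)\<close> give back the homomorphism to \<open>\<complex>\<^sub>3\<close>.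

  Forbidden induced subgraphs. This is the heart of the matter (\<open>andrasfai_colouring_if_free\<close>). Let \<open>G\<close>
  be \<open>{K\<^sub>3, K\<^sub>1 + 2K\<^sub>2, K\<^sub>1 + C\<^sub>5, C\<^sub>6}\<close>-free and fix a vertex \<open>z\<close>. The vertices that are not adjacent to \<open>z\<close>
  split into two independent sets \<open>A\<close> and \<open>B\<close>, and the neighbourhood \<open>M\<close> of \<open>z\<close> is a third one.
  Put \<open>z\<close> at 0 and look for positions with \<open>A\<close>, \<open>M\<close> and \<open>B\<close> in the first, second and last third of
  the circle. Measured from the start of its third, the position of a vertex only has to be
  strictly smaller than that of any neighbour in the cyclically next class (\<open>A\<close> to \<open>M\<close> to \<open>B\<close> to
  \<open>A\<close>). So it suffices that the edges outside \<open>z\<close>, directed in this cyclic sense, have no directed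
  cycle. Any chord of a directed cycle splits off a shorter directed cycle, and all lengths are
  divisible by 3; a shortest directed cycle is therefore a triangle, an induced hexagon, or an
  induced cycle of length at least 9, which contains \<open>K\<^sub>1 + 2K\<^sub>2\<close>.

  Maximal triangle-free graphs. In such a graph, excluding an induced \<open>C\<^sub>6\<close> already excludes
  \<open>K\<^sub>1 + 2K\<^sub>2\<close> and \<open>K\<^sub>1 + C\<^sub>5\<close> (\<open>free_if_maximal_triangle_free\<close>), and an induced \<open>C\<^sub>6\<close> together with common
  neighbours of its opposite vertices is exactly the Petersen graph minus a vertex
  (\<open>contains_petersen_minus_vertex_iff\<close>). For the existence of the extension take a colouring with
  minimal \<open>k\<close>: it uses all colours, because omitting one would allow a colouring with \<open>k - 1\<close>. Joining
  all pairs of vertices with adjacent colours then gives a blow-up of the Andrasfai graph, which is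
  maximal triangle-free and has no induced \<open>C\<^sub>6\<close> (\<open>maximal_extension_if_andrasfai\<close>).

  Unit arcs. Two unit arcs on a circle of length \<open>L\<close> are disjoint iff their starting points are more
  than 1 apart in both directions. If \<open>L \<le> 3\<close>, the starting points of a model are positions as above.
  If \<open>L > 3\<close>, the disjointness graph of the arcs has no induced \<open>K\<^sub>1 + 2K\<^sub>2\<close>, \<open>K\<^sub>1 + C\<^sub>5\<close> or \<open>C\<^sub>6\<close>
  (\<open>circle_graph_free\<close>), and it is triangle-free since the intersection graph is \<open>3K\<^sub>1\<close>-free.
  Conversely, an Andrasfai colouring, perturbed so as to become injective, gives unit arcs on a circle
  slightly longer than 3, where every pairwise intersecting family has a common point.\<close>

section \<open>Forbidden induced subgraphs as patterns of adjacencies\<close>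

definition adj :: "'a graph \<Rightarrow> 'a \<Rightarrow> 'a \<Rightarrow> bool" where
  "adj G u v \<longleftrightarrow> {u, v} \<in> edges G"

lemmas isomorphic_iff = isomorphic_def[folded adj_def]

lemma adj_sym: "adj G u v \<longleftrightarrow> adj G v u"
  by (simp add: adj_def insert_commute)

lemma adj_swap: "adj G u v \<Longrightarrow> adj G v u"
  by (simp add: adj_sym)

lemma adjD:
  assumes "is_graph G" "adj G u v"
  shows "u \<in> verts G" "v \<in> verts G" "u \<noteq> v"
proof -
  from assms obtain x y where "x \<in> verts G" "y \<in> verts G" "x \<noteq> y" "{u, v} = {x, y}"
    unfolding is_graph_def adj_def by blast
  then show "u \<in> verts G" "v \<in> verts G" "u \<noteq> v"
    by (auto simp: doubleton_eq_iff)
qed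

lemma adj_irrefl: "is_graph G \<Longrightarrow> \<not> adj G v v"
  using adjD(3) by fast

lemma isomorphic_commute: "isomorphic G H \<longleftrightarrow> isomorphic H G"
proof -
  have "isomorphic H G" if iso: "isomorphic G H" for G :: "'x graph" and H :: "'y graph"
  proof -
    from iso obtain f where f: "bij_betw f (verts G) (verts H)"
      and e: "\<forall>x\<in>verts G. \<forall>y\<in>verts G. adj G x y \<longleftrightarrow> adj H (f x) (f y)"
      unfolding isomorphic_iff by blast
    let ?g = "inv_into (verts G) f"
    have g: "bij_betw ?g (verts H) (verts G)"
      by (rule bij_betw_inv_into[OF f])
    have "adj H x y \<longleftrightarrow> adj G (?g x) (?g y)" if "x \<in> verts H" "y \<in> verts H" for x y
    proof -
      have "?g x \<in> verts G" "?g y \<in> verts G"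
        using that g by (auto dest: bij_betwE)
      with e have "adj G (?g x) (?g y) \<longleftrightarrow> adj H (f (?g x)) (f (?g y))" by blast
      then show ?thesis
        using that f by (simp add: bij_betw_inv_into_right)
    qed
    with g show ?thesis unfolding isomorphic_iff by blast
  qed
  from this[of G H] this[of H G] show ?thesis by blast
qed

lemma adj_induced:
  "verts (induced G W) = W" "adj (induced G W) x y \<longleftrightarrow> adj G x y \<and> x \<in> W \<and> y \<in> W"
  by (auto simp: induced_def adj_def)

lemma free_of_iff:
  "free_of H G \<longleftrightarrow> \<not> (\<exists>f. inj_on f (verts H) \<and> f ` verts H \<subseteq> verts G \<and>
     (\<forall>x\<in>verts H. \<forall>y\<in>verts H. adj H x y \<longleftrightarrow> adj G (f x) (f y)))" (is "_ \<longleftrightarrow> \<not> ?R")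
proof -
  have "(\<exists>W\<subseteq>verts G. isomorphic H (induced G W)) \<longleftrightarrow> ?R"
  proof
    assume "\<exists>W\<subseteq>verts G. isomorphic H (induced G W)"
    then show ?R
      unfolding isomorphic_iff bij_betw_def by (fastforce simp: adj_induced)
  next
    assume ?R
    then obtain f where f: "inj_on f (verts H)" "f ` verts H \<subseteq> verts G"
      "\<forall>x\<in>verts H. \<forall>y\<in>verts H. adj H x y \<longleftrightarrow> adj G (f x) (f y)" by blast
    then have "isomorphic H (induced G (f ` verts H))"
      unfolding isomorphic_iff bij_betw_def by (intro exI[of _ f]) (auto simp: adj_induced)
    with f(2) show "\<exists>W\<subseteq>verts G. isomorphic H (induced G W)" by blast
  qed
  then show ?thesis
    unfolding free_of_def by (subst isomorphic_commute) blast
qed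

text \<open>The image of an injective edge-preserving map need not be an induced subgraph; the witness keeps
  only the images of the edges of \<open>H\<close>.\<close>

lemma contains_subgraph_iff:
  assumes "is_graph H" "is_graph G"
  shows "contains_subgraph G H \<longleftrightarrow> (\<exists>f. inj_on f (verts H) \<and> f ` verts H \<subseteq> verts G \<and>
     (\<forall>x\<in>verts H. \<forall>y\<in>verts H. adj H x y \<longrightarrow> adj G (f x) (f y)))" (is "_ \<longleftrightarrow> ?R")
proof
  assume "contains_subgraph G H"
  then obtain S where S: "verts S \<subseteq> verts G" "edges S \<subseteq> edges G" and "isomorphic H S"
    unfolding contains_subgraph_def subgraph_def using isomorphic_commute by blast
  then obtain f where "inj_on f (verts H)" "f ` verts H = verts S"
    "\<forall>x\<in>verts H. \<forall>y\<in>verts H. adj H x y \<longleftrightarrow> adj S (f x) (f y)"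
    unfolding isomorphic_iff bij_betw_def by blast
  with S show ?R by (intro exI[of _ f]) (auto simp: adj_def)
next
  assume ?R
  then obtain f where f: "inj_on f (verts H)" "f ` verts H \<subseteq> verts G"
      "\<forall>x\<in>verts H. \<forall>y\<in>verts H. adj H x y \<longrightarrow> adj G (f x) (f y)" by blast
  define S where "S = \<lparr>verts = f ` verts H,
    edges = {{f x, f y} | x y. x \<in> verts H \<and> y \<in> verts H \<and> adj H x y}\<rparr>"
  have S: "adj S (f x) (f y) \<longleftrightarrow> adj H x y" if "x \<in> verts H" "y \<in> verts H" for x y
  proof
    assume "adj S (f x) (f y)"
    then obtain x' y' where *: "{f x, f y} = {f x', f y'}" "x' \<in> verts H" "y' \<in> verts H" "adj H x' y'"
      by (auto simp: S_def adj_def)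
    then have "x = x' \<and> y = y' \<or> x = y' \<and> y = x'"
      using that inj_onD[OF f(1)] unfolding doubleton_eq_iff by blast
    with *(4) show "adj H x y" by (auto simp: adj_sym)
  qed (use that in \<open>auto simp: S_def adj_def\<close>)
  have "is_graph S"
    unfolding is_graph_def
  proof (intro conjI ballI)
    show "verts S \<noteq> {}" using assms(1) by (auto simp: S_def is_graph_def)
    fix e assume "e \<in> edges S"
    then obtain x y where xy: "e = {f x, f y}" "x \<in> verts H" "y \<in> verts H" "adj H x y"
      by (auto simp: S_def)
    then have "f x \<noteq> f y" using f(1) adjD(3)[OF assms(1)] by (metis inj_onD)
    with xy show "\<exists>u\<in>verts S. \<exists>v\<in>verts S. u \<noteq> v \<and> e = {u, v}"
      by (auto simp: S_def)
  qed
  then have "subgraph S G"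
    using f by (auto simp: subgraph_def S_def adj_def)
  moreover have "isomorphic H S"
    unfolding isomorphic_iff
    by (intro exI[of _ f]) (use f S in \<open>auto simp: bij_betw_def S_def\<close>)
  ultimately show "contains_subgraph G H"
    unfolding contains_subgraph_def using isomorphic_commute by blast
qed

text \<open>Small graphs are embedded by listing their vertices together with the intended images; only
  pairs of list positions in increasing order have to be inspected.\<close>

lemma embedding_by_lists:
  assumes "distinct xs" "length ys = length xs"
    and P: "sorted_wrt (\<lambda>(x, u) (y, v). u \<noteq> v \<and> P x y u v) (zip xs ys)"
    and sym: "\<And>x y u v. P x y u v \<Longrightarrow> P y x v u"
  obtains f where "inj_on f (set xs)" "f ` set xs = set ys"
    "\<And>x y. x \<in> set xs \<Longrightarrow> y \<in> set xs \<Longrightarrow> x \<noteq> y \<Longrightarrow> P x y (f x) (f y)"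
proof
  let ?f = "the \<circ> map_of (zip xs ys)"
  have f: "?f (xs ! i) = ys ! i" if "i < length xs" for i
    using that assms(1,2) by (simp add: map_of_zip_nth)
  have *: "ys ! i \<noteq> ys ! j \<and> P (xs ! i) (xs ! j) (ys ! i) (ys ! j)" if "i < j" "j < length xs" for i j
    using P that assms(2) by (auto simp: sorted_wrt_iff_nth_less)
  have **: "ys ! i \<noteq> ys ! j \<and> P (xs ! i) (xs ! j) (ys ! i) (ys ! j)"
    if "i < length xs" "j < length xs" "i \<noteq> j" for i j
    using *[of i j] *[of j i] sym that by (cases "i < j") auto
  show "inj_on ?f (set xs)"
    by (rule inj_onI) (metis ** f in_set_conv_nth)
  show "?f ` set xs = set ys"
    using f assms(2) by (force simp: set_conv_nth image_iff)
  show "P x y (?f x) (?f y)" if "x \<in> set xs" "y \<in> set xs" "x \<noteq> y" for x y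
    using that ** f by (metis in_set_conv_nth)
qed

lemma induced_copy_by_lists:
  assumes G: "is_graph G" "set ys \<subseteq> verts G" and H: "is_graph H" "verts H = set xs"
    and "distinct xs" "length ys = length xs"
    and P: "sorted_wrt (\<lambda>(x, u) (y, v). u \<noteq> v \<and> (adj H x y \<longleftrightarrow> adj G u v)) (zip xs ys)"
  shows "\<not> free_of H G"
proof -
  obtain f where "inj_on f (set xs)" "f ` set xs = set ys"
    "\<And>x y. x \<in> set xs \<Longrightarrow> y \<in> set xs \<Longrightarrow> x \<noteq> y \<Longrightarrow> adj H x y \<longleftrightarrow> adj G (f x) (f y)"
    by (rule embedding_by_lists[OF assms(5,6) P]) (auto simp: adj_sym)
  then show ?thesis
    unfolding free_of_iff H(2) using G H adj_irrefl by (metis (no_types, lifting))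
qed

lemma subgraph_by_lists:
  assumes G: "is_graph G" "set ys \<subseteq> verts G" and H: "is_graph H" "verts H = set xs"
    and "distinct xs" "length ys = length xs"
    and P: "sorted_wrt (\<lambda>(x, u) (y, v). u \<noteq> v \<and> (adj H x y \<longrightarrow> adj G u v)) (zip xs ys)"
  shows "contains_subgraph G H"
proof -
  obtain f where "inj_on f (set xs)" "f ` set xs = set ys"
    "\<And>x y. x \<in> set xs \<Longrightarrow> y \<in> set xs \<Longrightarrow> x \<noteq> y \<Longrightarrow> adj H x y \<longrightarrow> adj G (f x) (f y)"
    by (rule embedding_by_lists[OF assms(5,6) P]) (auto simp: adj_sym)
  then show ?thesis
    unfolding contains_subgraph_iff[OF H(1) G(1)] H(2) using G H adj_irrefl
    by (metis (no_types, lifting))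
qed

lemma adj_complete_graph: "adj (complete_graph n) i j \<longleftrightarrow> i < n \<and> j < n \<and> i \<noteq> j"
  by (auto simp: complete_graph_def adj_def doubleton_eq_iff)

lemma adj_disjoint_union:
  "adj (disjoint_union G H) (Inl a) (Inl a') \<longleftrightarrow> adj G a a'"
  "adj (disjoint_union G H) (Inr b) (Inr b') \<longleftrightarrow> adj H b b'"
  "\<not> adj (disjoint_union G H) (Inl a) (Inr b)"
  "\<not> adj (disjoint_union G H) (Inr b) (Inl a)"
proof -
  have *: "Inl ` e = {Inl a, Inl a'} \<longleftrightarrow> e = {a, a'}" for e :: "'a set" and a a'
    using inj_image_eq_iff[OF inj_Inl, of e "{a, a'}"] by simp
  have **: "Inr ` e = {Inr b, Inr b'} \<longleftrightarrow> e = {b, b'}" for e :: "'b set" and b b'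
    using inj_image_eq_iff[OF inj_Inr, of e "{b, b'}"] by simp
  show "adj (disjoint_union G H) (Inl a) (Inl a') \<longleftrightarrow> adj G a a'"
    "adj (disjoint_union G H) (Inr b) (Inr b') \<longleftrightarrow> adj H b b'"
    by (auto simp: adj_def disjoint_union_def image_iff * ** eq_commute[of "{_, _}"])
  show "\<not> adj (disjoint_union G H) (Inl a) (Inr b)"
    "\<not> adj (disjoint_union G H) (Inr b) (Inl a)"
    by (auto simp: adj_def disjoint_union_def image_iff)
qed

lemma is_graph_complete_graph: "n > 0 \<Longrightarrow> is_graph (complete_graph n)"
  unfolding is_graph_def complete_graph_def by auto

lemma is_graph_disjoint_union: "is_graph G \<Longrightarrow> is_graph H \<Longrightarrow> is_graph (disjoint_union G H)"
  unfolding is_graph_def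
proof (intro conjI ballI; elim conjE)
  assume "verts G \<noteq> {}" then show "verts (disjoint_union G H) \<noteq> {}"
    by (auto simp: disjoint_union_def)
next
  fix e assume e: "e \<in> edges (disjoint_union G H)"
    and G: "\<forall>e\<in>edges G. \<exists>x\<in>verts G. \<exists>y\<in>verts G. x \<noteq> y \<and> e = {x, y}"
    and H: "\<forall>e\<in>edges H. \<exists>x\<in>verts H. \<exists>y\<in>verts H. x \<noteq> y \<and> e = {x, y}"
  from e consider e' where "e' \<in> edges G" "e = Inl ` e'" | e' where "e' \<in> edges H" "e = Inr ` e'"
    by (auto simp: disjoint_union_def)
  then show "\<exists>x\<in>verts (disjoint_union G H). \<exists>y\<in>verts (disjoint_union G H). x \<noteq> y \<and> e = {x, y}"
  proof cases
    case 1
    with G obtain x y where xy: "x \<in> verts G" "y \<in> verts G" "x \<noteq> y" "e' = {x, y}" by blast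
    show ?thesis
      by (rule bexI[of _ "Inl x"], rule bexI[of _ "Inl y"])
        (use 1 xy in \<open>auto simp: disjoint_union_def\<close>)
  next
    case 2
    with H obtain x y where xy: "x \<in> verts H" "y \<in> verts H" "x \<noteq> y" "e' = {x, y}" by blast
    show ?thesis
      by (rule bexI[of _ "Inr x"], rule bexI[of _ "Inr y"])
        (use 2 xy in \<open>auto simp: disjoint_union_def\<close>)
  qed
qed

lemma edges_cycle_graph: "edges (cycle_graph n) = (\<lambda>i. {i, (i + 1) mod n}) ` {..<n}"
  by (auto simp: cycle_graph_def)

lemma is_graph_cycle_graph:
  assumes "n \<ge> 2"
  shows "is_graph (cycle_graph n)"
  unfolding is_graph_def
proof (intro conjI ballI)
  show "verts (cycle_graph n) \<noteq> {}" using assms by (auto simp: cycle_graph_def lessThan_empty_iff)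
  fix e assume "e \<in> edges (cycle_graph n)"
  then obtain i where i: "i < n" "e = {i, (i + 1) mod n}" by (auto simp: cycle_graph_def)
  have "i \<noteq> (i + 1) mod n" using i(1) assms by (cases "i + 1 = n") auto
  moreover have "i \<in> verts (cycle_graph n)" "(i + 1) mod n \<in> verts (cycle_graph n)"
    using i(1) by (simp_all add: cycle_graph_def)
  ultimately show "\<exists>x\<in>verts (cycle_graph n). \<exists>y\<in>verts (cycle_graph n). x \<noteq> y \<and> e = {x, y}"
    using i(2) by metis
qed

lemma free_of_K3_iff:
  assumes "is_graph G"
  shows "free_of K\<^sub>3 G \<longleftrightarrow> (\<forall>a b c. adj G a b \<longrightarrow> adj G b c \<longrightarrow> \<not> adj G a c)"
proof
  assume free: "free_of K\<^sub>3 G"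
  show "\<forall>a b c. adj G a b \<longrightarrow> adj G b c \<longrightarrow> \<not> adj G a c"
  proof (intro allI impI notI)
    fix a b c assume e: "adj G a b" "adj G b c" "adj G a c"
    have v: "a \<in> verts G" "b \<in> verts G" "c \<in> verts G" "a \<noteq> b" "b \<noteq> c" "a \<noteq> c"
      using adjD[OF assms e(1)] adjD[OF assms e(2)] adjD[OF assms e(3)] by auto
    have "\<not> free_of K\<^sub>3 G"
      by (rule induced_copy_by_lists[where xs = "[0, 1, 2]" and ys = "[a, b, c]"])
        (use assms v e in \<open>simp_all add: is_graph_complete_graph adj_complete_graph\<close>,
         auto simp: complete_graph_def)
    with free show False by blast
  qed
next
  assume tri: "\<forall>a b c. adj G a b \<longrightarrow> adj G b c \<longrightarrow> \<not> adj G a c"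
  show "free_of K\<^sub>3 G"
    unfolding free_of_iff
  proof clarify
    fix f assume "\<forall>x\<in>verts K\<^sub>3. \<forall>y\<in>verts K\<^sub>3. adj K\<^sub>3 x y \<longleftrightarrow> adj G (f x) (f y)"
    then have *: "adj G (f x) (f y)" if "x < 3" "y < 3" "x \<noteq> y" for x y
      using that by (auto simp: adj_complete_graph) (auto simp: complete_graph_def)
    show False using tri *[of 0 1] *[of 1 2] *[of 0 2] by auto
  qed
qed

text \<open>In this and the following two patterns the vertices are automatically distinct: identifying
  two of them would make some pair both adjacent and non-adjacent.\<close>

lemma free_of_K1_plus_2K2_iff:
  assumes "is_graph G"
  shows "free_of K1_plus_2K2 G \<longleftrightarrow> \<not> (\<exists>w a b c d. w \<in> verts G \<and> adj G a b \<and> adj G c d \<and>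
    \<not> adj G w a \<and> \<not> adj G w b \<and> \<not> adj G w c \<and> \<not> adj G w d \<and>
    \<not> adj G a c \<and> \<not> adj G a d \<and> \<not> adj G b c \<and> \<not> adj G b d)" (is "_ \<longleftrightarrow> \<not> ?R")
proof -
  have V: "verts K1_plus_2K2 =
    {Inl 0, Inr (Inl 0), Inr (Inl 1), Inr (Inr 0), Inr (Inr 1)}"
    by (auto simp: disjoint_union_def complete_graph_def)
  have "(\<exists>f. inj_on f (verts K1_plus_2K2) \<and> f ` verts K1_plus_2K2 \<subseteq> verts G \<and>
     (\<forall>x\<in>verts K1_plus_2K2. \<forall>y\<in>verts K1_plus_2K2. adj K1_plus_2K2 x y \<longleftrightarrow> adj G (f x) (f y)))
     \<longleftrightarrow> ?R" (is "?L \<longleftrightarrow> _")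
  proof
    assume ?L
    then obtain f where f: "f ` verts K1_plus_2K2 \<subseteq> verts G"
      and e: "\<forall>x\<in>verts K1_plus_2K2. \<forall>y\<in>verts K1_plus_2K2. adj K1_plus_2K2 x y \<longleftrightarrow> adj G (f x) (f y)"
      by blast
    have e': "adj G (f x) (f y) \<longleftrightarrow> adj K1_plus_2K2 x y" if "x \<in> verts K1_plus_2K2" "y \<in> verts K1_plus_2K2" for x y
      using e that by blast
    show ?R
      by (rule exI[of _ "f (Inl 0)"], rule exI[of _ "f (Inr (Inl 0))"], rule exI[of _ "f (Inr (Inl 1))"],
          rule exI[of _ "f (Inr (Inr 0))"], rule exI[of _ "f (Inr (Inr 1))"],
          insert f, simp del: One_nat_def add: e' V adj_disjoint_union adj_complete_graph)
  next
    assume ?R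
    then obtain w a b c d where w: "w \<in> verts G" and e: "adj G a b" "adj G c d"
      and n: "\<not> adj G w a" "\<not> adj G w b" "\<not> adj G w c" "\<not> adj G w d"
        "\<not> adj G a c" "\<not> adj G a d" "\<not> adj G b c" "\<not> adj G b d" by blast
    have v: "a \<in> verts G" "b \<in> verts G" "c \<in> verts G" "d \<in> verts G"
      using adjD[OF assms e(1)] adjD[OF assms e(2)] by auto
    have s: "adj G b a" "adj G d c" "\<not> adj G a w" "\<not> adj G b w" "\<not> adj G c w" "\<not> adj G d w"
      "\<not> adj G c a" "\<not> adj G d a" "\<not> adj G c b" "\<not> adj G d b"
      using e n by (auto simp: adj_sym)
    have d: "w \<noteq> a" "w \<noteq> b" "w \<noteq> c" "w \<noteq> d" "a \<noteq> b" "a \<noteq> c" "a \<noteq> d" "b \<noteq> c" "b \<noteq> d" "c \<noteq> d"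
      using e n s adj_irrefl[OF assms] by auto
    have "\<not> free_of K1_plus_2K2 G"
      by (rule induced_copy_by_lists[where xs = "[Inl 0, Inr (Inl 0), Inr (Inl 1), Inr (Inr 0), Inr (Inr 1)]" and ys = "[w, a, b, c, d]"])
        (use e n d s v w assms in \<open>simp_all del: One_nat_def add: V adj_disjoint_union adj_complete_graph is_graph_disjoint_union is_graph_complete_graph\<close>)
    then show ?L unfolding free_of_iff by blast
  qed
  then show ?thesis unfolding free_of_iff by blast
qed

lemma free_of_K1_plus_C5_iff:
  assumes "is_graph G"
  shows "free_of K1_plus_C5 G \<longleftrightarrow> \<not> (\<exists>w a b c d e. w \<in> verts G \<and>
    adj G a b \<and> adj G b c \<and> adj G c d \<and> adj G d e \<and> adj G e a \<and>
    \<not> adj G w a \<and> \<not> adj G w b \<and> \<not> adj G w c \<and> \<not> adj G w d \<and> \<not> adj G w e \<and>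
    \<not> adj G a c \<and> \<not> adj G b d \<and> \<not> adj G c e \<and> \<not> adj G d a \<and> \<not> adj G e b)" (is "_ \<longleftrightarrow> \<not> ?R")
proof -
  have V5: "verts C\<^sub>5 = {0, 1, 2, 3, 4}" by (auto simp: cycle_graph_def)
  have E5: "edges C\<^sub>5 = {{0, 1}, {1, 2}, {2, 3}, {3, 4}, {4, 0}}"
    using V5 unfolding edges_cycle_graph by (simp del: One_nat_def add: cycle_graph_def)
  have V: "verts K1_plus_C5 = {Inl 0, Inr 0, Inr 1, Inr 2, Inr 3, Inr 4}"
    by (auto simp: disjoint_union_def V5) (auto simp: complete_graph_def)
  have "(\<exists>f. inj_on f (verts K1_plus_C5) \<and> f ` verts K1_plus_C5 \<subseteq> verts G \<and>
     (\<forall>x\<in>verts K1_plus_C5. \<forall>y\<in>verts K1_plus_C5. adj K1_plus_C5 x y \<longleftrightarrow> adj G (f x) (f y)))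
     \<longleftrightarrow> ?R" (is "?L \<longleftrightarrow> _")
  proof
    assume ?L
    then obtain f where f: "f ` verts K1_plus_C5 \<subseteq> verts G"
      and e: "\<forall>x\<in>verts K1_plus_C5. \<forall>y\<in>verts K1_plus_C5. adj K1_plus_C5 x y \<longleftrightarrow> adj G (f x) (f y)"
      by blast
    have e': "adj G (f x) (f y) \<longleftrightarrow> adj K1_plus_C5 x y" if "x \<in> verts K1_plus_C5" "y \<in> verts K1_plus_C5" for x y
      using e that by blast
    show ?R
      by (rule exI[of _ "f (Inl 0)"], rule exI[of _ "f (Inr 0)"], rule exI[of _ "f (Inr 1)"], rule exI[of _ "f (Inr 2)"],
          rule exI[of _ "f (Inr 3)"], rule exI[of _ "f (Inr 4)"],
          insert f, simp del: One_nat_def add: e' V adj_disjoint_union adj_def[of C\<^sub>5] E5 doubleton_eq_iff)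
  next
    assume ?R
    then obtain w a b c d g where w: "w \<in> verts G"
      and e: "adj G a b" "adj G b c" "adj G c d" "adj G d g" "adj G g a"
      and n: "\<not> adj G w a" "\<not> adj G w b" "\<not> adj G w c" "\<not> adj G w d" "\<not> adj G w g"
        "\<not> adj G a c" "\<not> adj G b d" "\<not> adj G c g" "\<not> adj G d a" "\<not> adj G g b" by blast
    have v: "a \<in> verts G" "b \<in> verts G" "c \<in> verts G" "d \<in> verts G" "g \<in> verts G"
      using adjD[OF assms e(1)] adjD[OF assms e(3)] adjD[OF assms e(4)] by auto
    have s: "adj G b a" "adj G c b" "adj G d c" "adj G g d" "adj G a g"
      "\<not> adj G a w" "\<not> adj G b w" "\<not> adj G c w" "\<not> adj G d w" "\<not> adj G g w"
      "\<not> adj G c a" "\<not> adj G d b" "\<not> adj G g c" "\<not> adj G a d" "\<not> adj G b g"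
      using e n by (auto simp: adj_sym)
    have d: "w \<noteq> a" "w \<noteq> b" "w \<noteq> c" "w \<noteq> d" "w \<noteq> g" "a \<noteq> b" "a \<noteq> c" "a \<noteq> d" "a \<noteq> g"
      "b \<noteq> c" "b \<noteq> d" "b \<noteq> g" "c \<noteq> d" "c \<noteq> g" "d \<noteq> g"
      using e n s adj_irrefl[OF assms] by auto
    have "\<not> free_of K1_plus_C5 G"
      by (rule induced_copy_by_lists[where xs = "[Inl 0, Inr 0, Inr 1, Inr 2, Inr 3, Inr 4]" and ys = "[w, a, b, c, d, g]"])
        (use e n d s v w assms in \<open>simp_all del: One_nat_def add: V adj_disjoint_union adj_def[of C\<^sub>5] E5 doubleton_eq_iff is_graph_disjoint_union is_graph_complete_graph is_graph_cycle_graph\<close>)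
    then show ?L unfolding free_of_iff by blast
  qed
  then show ?thesis unfolding free_of_iff by blast
qed

lemma free_of_C6_iff:
  assumes "is_graph G"
  shows "free_of C\<^sub>6 G \<longleftrightarrow> \<not> (\<exists>a b c d e f.
    adj G a b \<and> adj G b c \<and> adj G c d \<and> adj G d e \<and> adj G e f \<and> adj G f a \<and>
    \<not> adj G a c \<and> \<not> adj G b d \<and> \<not> adj G c e \<and> \<not> adj G d f \<and> \<not> adj G e a \<and> \<not> adj G f b \<and>
    \<not> adj G a d \<and> \<not> adj G b e \<and> \<not> adj G c f)" (is "_ \<longleftrightarrow> \<not> ?R")
proof -
  have V: "verts C\<^sub>6 = {0, 1, 2, 3, 4, 5}" by (auto simp: cycle_graph_def)
  have E: "edges C\<^sub>6 = {{0, 1}, {1, 2}, {2, 3}, {3, 4}, {4, 5}, {5, 0}}"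
    using V unfolding edges_cycle_graph by (simp del: One_nat_def add: cycle_graph_def)
  have "(\<exists>f. inj_on f (verts C\<^sub>6) \<and> f ` verts C\<^sub>6 \<subseteq> verts G \<and>
     (\<forall>x\<in>verts C\<^sub>6. \<forall>y\<in>verts C\<^sub>6. adj C\<^sub>6 x y \<longleftrightarrow> adj G (f x) (f y)))
     \<longleftrightarrow> ?R" (is "?L \<longleftrightarrow> _")
  proof
    assume ?L
    then obtain f where e: "\<forall>x\<in>verts C\<^sub>6. \<forall>y\<in>verts C\<^sub>6. adj C\<^sub>6 x y \<longleftrightarrow> adj G (f x) (f y)"
      by blast
    have e': "adj G (f x) (f y) \<longleftrightarrow> adj C\<^sub>6 x y" if "x \<in> verts C\<^sub>6" "y \<in> verts C\<^sub>6" for x y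
      using e that by blast
    show ?R
      by (rule exI[of _ "f 0"], rule exI[of _ "f 1"], rule exI[of _ "f 2"],
          rule exI[of _ "f 3"], rule exI[of _ "f 4"], rule exI[of _ "f 5"],
          simp del: One_nat_def add: e' V adj_def[of C\<^sub>6] E doubleton_eq_iff)
  next
    assume ?R
    then obtain a b c d g h where
      e: "adj G a b" "adj G b c" "adj G c d" "adj G d g" "adj G g h" "adj G h a"
      and n: "\<not> adj G a c" "\<not> adj G b d" "\<not> adj G c g" "\<not> adj G d h" "\<not> adj G g a" "\<not> adj G h b"
        "\<not> adj G a d" "\<not> adj G b g" "\<not> adj G c h" by blast
    have v: "a \<in> verts G" "b \<in> verts G" "c \<in> verts G" "d \<in> verts G" "g \<in> verts G" "h \<in> verts G"
      using adjD[OF assms e(1)] adjD[OF assms e(3)] adjD[OF assms e(5)] by auto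
    have s: "adj G b a" "adj G c b" "adj G d c" "adj G g d" "adj G h g" "adj G a h"
      "\<not> adj G c a" "\<not> adj G d b" "\<not> adj G g c" "\<not> adj G h d" "\<not> adj G a g" "\<not> adj G b h"
      "\<not> adj G d a" "\<not> adj G g b" "\<not> adj G h c"
      using e n by (auto simp: adj_sym)
    have d: "a \<noteq> b" "a \<noteq> c" "a \<noteq> d" "a \<noteq> g" "a \<noteq> h" "b \<noteq> c" "b \<noteq> d" "b \<noteq> g" "b \<noteq> h"
      "c \<noteq> d" "c \<noteq> g" "c \<noteq> h" "d \<noteq> g" "d \<noteq> h" "g \<noteq> h"
      using e n s adj_irrefl[OF assms] by auto
    have "\<not> free_of C\<^sub>6 G"
      by (rule induced_copy_by_lists[where xs = "[0, 1, 2, 3, 4, 5]" and ys = "[a, b, c, d, g, h]"])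
        (use e n d s v  assms in \<open>simp_all add: V adj_def[of C\<^sub>6] E doubleton_eq_iff is_graph_cycle_graph\<close>)
    then show ?L unfolding free_of_iff by blast
  qed
  then show ?thesis unfolding free_of_iff by blast
qed

text \<open>Here the three vertices have to be required to be distinct, since the pattern has no edges that
  would separate them.\<close>

lemma free_of_3K1_iff:
  assumes "is_graph G"
  shows "free_of (edgeless_graph 3) G \<longleftrightarrow> \<not> (\<exists>a b c. a \<in> verts G \<and> b \<in> verts G \<and> c \<in> verts G \<and>
     a \<noteq> b \<and> b \<noteq> c \<and> a \<noteq> c \<and> \<not> adj G a b \<and> \<not> adj G b c \<and> \<not> adj G a c)"
proof
  have V: "verts (edgeless_graph 3) = {0, 1, 2}" by (auto simp: edgeless_graph_def)
  have E: "edges (edgeless_graph 3) = {}" by (simp add: edgeless_graph_def)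
  show "\<not> (\<exists>a b c. a \<in> verts G \<and> b \<in> verts G \<and> c \<in> verts G \<and>
    a \<noteq> b \<and> b \<noteq> c \<and> a \<noteq> c \<and> \<not> adj G a b \<and> \<not> adj G b c \<and> \<not> adj G a c)"
    if free: "free_of (edgeless_graph 3) G"
  proof clarify
    fix a b c assume abc: "a \<in> verts G" "b \<in> verts G" "c \<in> verts G"
      "a \<noteq> b" "b \<noteq> c" "a \<noteq> c" "\<not> adj G a b" "\<not> adj G b c" "\<not> adj G a c"
    then have "\<not> free_of (edgeless_graph 3) G"
      by (intro induced_copy_by_lists[where xs = "[0, 1, 2]" and ys = "[a, b, c]"])
        (simp_all add: assms V adj_def[of "edgeless_graph 3"] E is_graph_def[of "edgeless_graph 3"])
    with free show False by blast
  qed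
  show "free_of (edgeless_graph 3) G"
    if no: "\<not> (\<exists>a b c. a \<in> verts G \<and> b \<in> verts G \<and> c \<in> verts G \<and>
    a \<noteq> b \<and> b \<noteq> c \<and> a \<noteq> c \<and> \<not> adj G a b \<and> \<not> adj G b c \<and> \<not> adj G a c)"
    unfolding free_of_iff
  proof clarify
    fix f assume f: "inj_on f (verts (edgeless_graph 3))" "f ` verts (edgeless_graph 3) \<subseteq> verts G"
      "\<forall>x\<in>verts (edgeless_graph 3). \<forall>y\<in>verts (edgeless_graph 3).
        adj (edgeless_graph 3) x y \<longleftrightarrow> adj G (f x) (f y)"
    have "f 0 \<noteq> f 1" "f 1 \<noteq> f 2" "f 0 \<noteq> f 2"
      using f(1) by (auto simp: V inj_on_def)
    moreover have "f 0 \<in> verts G" "f 1 \<in> verts G" "f 2 \<in> verts G"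
      using f(2) by (auto simp: V)
    moreover have "\<not> adj G (f 0) (f 1)" "\<not> adj G (f 1) (f 2)" "\<not> adj G (f 0) (f 2)"
      using f(3) by (auto simp: V adj_def[of "edgeless_graph 3"] E)
    ultimately show False using no by blast
  qed
qed

lemma no_triangle: "\<lbrakk>is_graph G; free_of K\<^sub>3 G; adj G a b; adj G b c\<rbrakk> \<Longrightarrow> \<not> adj G a c"
  using free_of_K3_iff by blast

lemma no_K1_plus_2K2:
  "\<lbrakk>is_graph G; free_of K1_plus_2K2 G; w \<in> verts G; adj G a b; adj G c d;
    \<not> adj G w a; \<not> adj G w b; \<not> adj G w c; \<not> adj G w d\<rbrakk>
    \<Longrightarrow> adj G a c \<or> adj G a d \<or> adj G b c \<or> adj G b d"
  using free_of_K1_plus_2K2_iff[of G] by blast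

lemma no_C6:
  "\<lbrakk>is_graph G; free_of C\<^sub>6 G; adj G a b; adj G b c; adj G c d; adj G d e; adj G e f; adj G f a;
    \<not> adj G a c; \<not> adj G b d; \<not> adj G c e; \<not> adj G d f; \<not> adj G e a; \<not> adj G f b;
    \<not> adj G a d; \<not> adj G b e; \<not> adj G c f\<rbrakk> \<Longrightarrow> False"
  using free_of_C6_iff[of G] by blast

section \<open>Andrasfai colourings\<close>

text \<open>Colours are representatives in \<open>{0..<3 * k - 1}\<close> of residues modulo \<open>3 * k - 1\<close>. As
  \<open>(3 * k - 1) - k = 2 * k - 1\<close>, the condition on an edge says that both cyclic distances between the two
  colours are at least \<open>k\<close>.\<close>

definition andrasfai_colouring :: "int \<Rightarrow> ('a \<Rightarrow> int) \<Rightarrow> 'a graph \<Rightarrow> bool" where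
  "andrasfai_colouring k c G \<longleftrightarrow> k \<ge> 1 \<and> (\<forall>v\<in>verts G. 0 \<le> c v \<and> c v < 3 * k - 1) \<and>
     (\<forall>u v. adj G u v \<longrightarrow> k \<le> \<bar>c u - c v\<bar> \<and> \<bar>c u - c v\<bar> \<le> 2 * k - 1)"

section \<open>From forbidden induced subgraphs to colourings\<close>

lemma relpow_class_shift:
  fixes \<kappa> :: "'a \<Rightarrow> nat"
  assumes "\<And>x y. (x, y) \<in> R \<Longrightarrow> \<kappa> y mod 3 = (\<kappa> x + 1) mod 3" "(x, y) \<in> R ^^ n"
  shows "\<kappa> y mod 3 = (\<kappa> x + n) mod 3"
  using assms(2)
proof (induction n arbitrary: y)
  case (Suc n)
  then obtain z where z: "(x, z) \<in> R ^^ n" "(z, y) \<in> R" by auto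
  have "\<kappa> y mod 3 = (\<kappa> z mod 3 + 1) mod 3" using assms(1)[OF z(2)] by (simp add: mod_simps)
  also have "\<dots> = (\<kappa> x + Suc n) mod 3" unfolding Suc.IH[OF z(1)] by (simp add: mod_simps)
  finally show ?case .
qed simp

lemma relpow_6E:
  assumes "(x, y) \<in> R ^^ 6"
  obtains b c d e f where
    "(x, b) \<in> R" "(b, c) \<in> R" "(c, d) \<in> R" "(d, e) \<in> R" "(e, f) \<in> R" "(f, y) \<in> R"
  using assms by (auto simp: numeral_eq_Suc)

text \<open>If the edges inside a properly 3-coloured vertex set are directed in the cyclic order of the colours,
  then the two ends of a chord of a directed walk are joined by an edge in one of the two directions,
  according to their distance on the walk modulo 3. A closed directed walk of length 3 is a triangle,
  one of length 6 an induced \<open>C\<^sub>6\<close>. On a longer closed walk \<open>a b c d e f g \<dots>\<close> the vertex \<open>a\<close> and the edges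
  \<open>c d\<close> and \<open>f g\<close> cannot induce \<open>K\<^sub>1 + 2K\<^sub>2\<close>. An edge between \<open>a\<close> and \<open>f\<close> would be directed
  backwards and close a walk of length 6, which leaves \<open>c g\<close> as the only possible further adjacency. It is
  directed forwards and shortens the walk by 3.\<close>

lemma cyclic_orientation_acyclic:
  fixes \<kappa> :: "'a \<Rightarrow> nat"
  assumes G: "is_graph G" and U: "U \<subseteq> verts G"
    and free: "free_of K\<^sub>3 G" "free_of K1_plus_2K2 G" "free_of C\<^sub>6 G"
    and proper: "\<And>x y. x \<in> U \<Longrightarrow> y \<in> U \<Longrightarrow> adj G x y \<Longrightarrow> \<kappa> x mod 3 \<noteq> \<kappa> y mod 3"
  defines "R \<equiv> {(x, y). x \<in> U \<and> y \<in> U \<and> adj G x y \<and> \<kappa> y mod 3 = (\<kappa> x + 1) mod 3}"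
  shows "acyclic R"
proof -
  have adj: "adj G x y" "adj G y x" if "(x, y) \<in> R" for x y
    using that by (auto simp: R_def adj_sym)
  have inU: "x \<in> U" "y \<in> U" if "(x, y) \<in> R" for x y
    using that by (auto simp: R_def)
  have shift: "\<kappa> y mod 3 = (\<kappa> x + n) mod 3" if "(x, y) \<in> R ^^ n" for x y n
    by (rule relpow_class_shift[OF _ that]) (auto simp: R_def)
  have two: "\<not> adj G x z" "\<not> adj G z x" if "(x, y) \<in> R" "(y, z) \<in> R" for x y z
    using no_triangle[OF G free(1)] adj that adj_swap by metis+
  have three: "\<not> adj G x x'" "\<not> adj G x' x" if "(x, y) \<in> R" "(y, z) \<in> R" "(z, x') \<in> R" for x y z x'
  proof -
    have "(x, x') \<in> R ^^ 3" using that by (auto simp: numeral_3_eq_3)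
    from shift[OF this] have "\<kappa> x mod 3 = \<kappa> x' mod 3" by simp
    then show "\<not> adj G x x'" "\<not> adj G x' x"
      using proper that inU adj_swap by metis+
  qed
  have no6: False
    if "(a, b) \<in> R" "(b, c) \<in> R" "(c, d) \<in> R" "(d, e) \<in> R" "(e, f) \<in> R" "(f, a) \<in> R" for a b c d e f
    by (rule no_C6[OF G free(3) that[THEN adj(1)] two(1)[OF that(1,2)] two(1)[OF that(2,3)]
          two(1)[OF that(3,4)] two(1)[OF that(4,5)] two(1)[OF that(5,6)] two(1)[OF that(6,1)]
          three(1)[OF that(1-3)] three(1)[OF that(2-4)] three(1)[OF that(3-5)]])
  have shorten: "(c, g) \<in> R"
    if w: "(a, b) \<in> R" "(b, c) \<in> R" "(c, d) \<in> R" "(d, e) \<in> R" "(e, f) \<in> R" "(f, g) \<in> R"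
    for a b c d e f g
  proof -
    note walk = relpow_Suc_I[OF relpow_Suc_I[OF relpow_Suc_I[OF relpow_Suc_I[OF relpow_Suc_I[OF
      relpow_0_I w(1)] w(2)] w(3)] w(4)] w(5)]
    note walk' = relpow_Suc_I[OF relpow_Suc_I[OF relpow_Suc_I[OF relpow_Suc_I[OF
      relpow_0_I w(3)] w(4)] w(5)] w(6)]
    have U': "a \<in> U" "c \<in> U" "f \<in> U" "g \<in> U" using w inU by auto
    have "\<not> adj G a f"
    proof
      assume "adj G a f"
      moreover from shift[OF walk] have "\<kappa> a mod 3 = (\<kappa> f + 1) mod 3"
        by (simp add: mod_Suc split: if_splits)
      ultimately have "(f, a) \<in> R" using U' by (auto simp: R_def adj_sym)
      with no6 w show False by blast
    qed
    moreover have "\<not> adj G a g"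
    proof
      assume "adj G a g"
      moreover from shift[OF relpow_Suc_I[OF walk w(6)]] have "\<kappa> a mod 3 = \<kappa> g mod 3"
        by (simp add: mod_Suc split: if_splits)
      ultimately show False using proper U' by blast
    qed
    moreover have "a \<in> verts G" using U' U by auto
    ultimately have "adj G c g"
      using no_K1_plus_2K2[OF G free(2), of a c d f g] adj(1)[OF w(3)] adj(1)[OF w(6)]
        two(1)[OF w(1,2)] three(1)[OF w(1-3)] three(1)[OF w(3-5)] two(1)[OF w(4,5)]
        three(1)[OF w(4-6)] by blast
    moreover from shift[OF walk'] have "\<kappa> g mod 3 = (\<kappa> c + 1) mod 3"
        by (simp add: mod_Suc split: if_splits)
    ultimately show "(c, g) \<in> R" using U' by (auto simp: R_def)
  qed
  have "(x, x) \<notin> R ^^ n" if "n > 0" for n x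
    using that
  proof (induction n arbitrary: x rule: less_induct)
    case (less n)
    show ?case
    proof
      assume walk: "(x, x) \<in> R ^^ n"
      have "n mod 3 = 0" using shift[OF walk] by presburger
      with less.prems have "n = 3 \<or> n = 6 \<or> n \<ge> 9" by presburger
      then consider "n = 3" | "n = 6" | "n \<ge> 9" by blast
      then show False
      proof cases
        case 1
        with walk obtain b c where "(x, b) \<in> R" "(b, c) \<in> R" "(c, x) \<in> R"
          by (auto simp: numeral_3_eq_3)
        with two(2) adj(1) show False by blast
      next
        case 2
        with walk have "(x, x) \<in> R ^^ 6" by simp
        then show False using no6 by (rule relpow_6E)
      next
        case 3
        define m where "m = n - 6"
        then have m: "n = 6 + m" "m \<ge> 3" using 3 by auto
        then obtain g where "(x, g) \<in> R ^^ 6" and g: "(g, x) \<in> R ^^ m"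
          using walk by (auto simp: relpow_add)
        from this(1) obtain b c d e f where w: "(x, b) \<in> R" "(b, c) \<in> R" "(c, d) \<in> R" "(d, e) \<in> R"
          "(e, f) \<in> R" "(f, g) \<in> R"
          by (rule relpow_6E)
        then have "(x, g) \<in> R ^^ 3"
          using shorten[OF w] by (auto simp: numeral_3_eq_3)
        with g have "(x, x) \<in> R ^^ (3 + m)" by (auto simp: relpow_add)
        with less.IH[of "3 + m" x] m show False by simp
      qed
    qed
  qed
  then show ?thesis
    unfolding acyclic_def by (meson trancl_power)
qed

text \<open>The rank of a vertex is its number of proper predecessors.\<close>

lemma rank_of_acyclic:
  assumes "finite V" "acyclic R" "R \<subseteq> V \<times> V"
  obtains \<rho> :: "'a \<Rightarrow> int" where
    "\<And>v. 0 \<le> \<rho> v \<and> \<rho> v \<le> int (card V)" "\<And>x y. (x, y) \<in> R \<Longrightarrow> \<rho> x < \<rho> y"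
proof
  let ?P = "\<lambda>v. {u \<in> V. (u, v) \<in> R\<^sup>+}"
  show "0 \<le> int (card (?P v)) \<and> int (card (?P v)) \<le> int (card V)" for v
    using card_mono[OF assms(1), of "?P v"] by auto
  show "int (card (?P x)) < int (card (?P y))" if xy: "(x, y) \<in> R" for x y
  proof -
    have "x \<in> ?P y" "x \<notin> ?P x" using xy assms by (auto simp: acyclic_def)
    moreover have "?P x \<subseteq> ?P y" using xy by auto
    ultimately have "?P x \<subset> ?P y" by blast
    then show ?thesis using assms(1) by (simp add: psubset_card_mono)
  qed
qed

text \<open>Let \<open>a\<close> have the most neighbours inside \<open>X\<close>; these neighbours form \<open>B\<close>. An edge \<open>x y\<close> in the rest of
  \<open>X\<close> would force every \<open>b \<in> B\<close> to be adjacent to \<open>x\<close> or \<open>y\<close>, for otherwise \<open>z\<close>, \<open>a b\<close> and \<open>x y\<close> induce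
  \<open>K\<^sub>1 + 2K\<^sub>2\<close>. Two such vertices \<open>b\<close>, \<open>b'\<close> with different choices would complete \<open>a b x y b'\<close> to a
  pentagon not adjacent to \<open>z\<close>. So one of \<open>x\<close>, \<open>y\<close> is adjacent to all of \<open>B\<close> and to the other one,
  and has more neighbours than \<open>a\<close>.\<close>

lemma bipartite_non_neighbourhood:
  assumes G: "finite_graph G" and z: "z \<in> verts G"
    and free: "free_of K\<^sub>3 G" "free_of K1_plus_2K2 G" "free_of K1_plus_C5 G"
  defines "X \<equiv> {v \<in> verts G. v \<noteq> z \<and> \<not> adj G z v}"
  obtains A B where "A \<inter> B = {}" "A \<union> B = X" "\<And>x y. x \<in> A \<Longrightarrow> y \<in> A \<Longrightarrow> \<not> adj G x y"
    "\<And>x y. x \<in> B \<Longrightarrow> y \<in> B \<Longrightarrow> \<not> adj G x y"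
proof (cases "X = {}")
  case True
  with that[of "{}" "{}"] show ?thesis by simp
next
  case False
  have g: "is_graph G" and fin: "finite X" using G by (auto simp: finite_graph_def X_def)
  define N where "N = (\<lambda>v. {w \<in> X. adj G v w})"
  have finN: "finite (N v)" for v using fin by (simp add: N_def)
  obtain a where a: "a \<in> X" and max: "\<And>v. v \<in> X \<Longrightarrow> card (N v) \<le> card (N a)"
    using obtains_MAX[OF fin False, of "\<lambda>v. card (N v)"] fin
    by (metis Max_ge finite_imageI imageI)
  have "\<not> adj G x y" if xy: "x \<in> X - N a" "y \<in> X - N a" for x y
  proof
    assume e: "adj G x y"
    have nz: "\<not> adj G z v" if "v \<in> X" for v using that by (simp add: X_def)
    have na: "\<not> adj G a x" "\<not> adj G a y" using xy by (auto simp: N_def)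
    have one: "adj G b x \<or> adj G b y" if "b \<in> N a" for b
      using no_K1_plus_2K2[OF g free(2) z, of a b x y] that xy a nz na e by (auto simp: N_def)
    have "\<not> (adj G b x \<and> adj G b' y)" if b: "b \<in> N a" "b' \<in> N a" for b b'
    proof
      assume bxy: "adj G b x \<and> adj G b' y"
      have ab: "adj G a b" "adj G a b'" "b \<in> X" "b' \<in> X" using b by (auto simp: N_def)
      have "\<not> adj G b b'" "\<not> adj G b y" "\<not> adj G b' x"
        using no_triangle[OF g free(1)] ab bxy e adj_swap by metis+
      then have "adj G a b \<and> adj G b x \<and> adj G x y \<and> adj G y b' \<and> adj G b' a \<and>
        \<not> adj G a x \<and> \<not> adj G b y \<and> \<not> adj G x b' \<and> \<not> adj G y a \<and> \<not> adj G b' b"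
        using ab bxy e na adj_swap by metis
      moreover have "\<not> adj G z a" "\<not> adj G z b" "\<not> adj G z x" "\<not> adj G z y" "\<not> adj G z b'"
        using nz a xy ab by auto
      ultimately show False
        using free(3) z unfolding free_of_K1_plus_C5_iff[OF g] by blast
    qed
    with one consider "\<forall>b\<in>N a. adj G x b" | "\<forall>b\<in>N a. adj G y b"
      using adj_swap by metis
    then obtain u v where uv: "u \<in> X" "v \<in> X" "v \<notin> N a" "adj G u v" "\<forall>b\<in>N a. adj G u b"
      using xy e adj_sym by (metis DiffD1 DiffD2)
    then have "N a \<subset> N u" by (auto simp: N_def)
    then have "card (N a) < card (N u)" using finN by (simp add: psubset_card_mono)
    with max[OF uv(1)] show False by simp
  qed
  moreover have "\<not> adj G x y" if "x \<in> N a" "y \<in> N a" for x y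
    using that no_triangle[OF g free(1), of x a y] by (auto simp: N_def adj_sym)
  moreover have "N a \<subseteq> X" by (auto simp: N_def)
  ultimately show ?thesis using that[of "X - N a" "N a"] by blast
qed

text \<open>The classes 0, 1 and 2 below are \<open>A\<close>, the neighbourhood of \<open>z\<close>, and \<open>B\<close>. A vertex of class \<open>i\<close>
  and rank \<open>r\<close> receives the colour \<open>i * k + r\<close>. Along a directed edge the rank increases: from class
  0 to 1 and from 1 to 2 the difference of the colours is then at least \<open>k\<close>, and from class 2 to 0 it is
  at most \<open>2 * k - 1\<close>.\<close>

proposition andrasfai_colouring_if_free:
  assumes G: "finite_graph G"
    and free: "free_of K\<^sub>3 G" "free_of K1_plus_2K2 G" "free_of K1_plus_C5 G" "free_of C\<^sub>6 G"
  shows "\<exists>k c. andrasfai_colouring k c G"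
proof -
  have g: "is_graph G" and fin: "finite (verts G)" using G by (auto simp: finite_graph_def)
  then obtain z where z: "z \<in> verts G" by (auto simp: is_graph_def)
  define U where "U = verts G - {z}"
  obtain A B where AB: "A \<inter> B = {}" "A \<union> B = {v \<in> verts G. v \<noteq> z \<and> \<not> adj G z v}"
    and A: "\<And>x y. x \<in> A \<Longrightarrow> y \<in> A \<Longrightarrow> \<not> adj G x y"
    and B: "\<And>x y. x \<in> B \<Longrightarrow> y \<in> B \<Longrightarrow> \<not> adj G x y"
    using bipartite_non_neighbourhood[OF G z free(1-3)] by blast
  define \<kappa> :: "'a \<Rightarrow> nat" where "\<kappa> v = (if v \<in> A then 0 else if v \<in> B then 2 else 1)" for v
  define R where "R = {(x, y). x \<in> U \<and> y \<in> U \<and> adj G x y \<and> \<kappa> y mod 3 = (\<kappa> x + 1) mod 3}"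
  have M: "adj G z v" if "v \<in> U" "v \<notin> A" "v \<notin> B" for v
    using that AB(2) by (auto simp: U_def)
  have "\<kappa> x mod 3 \<noteq> \<kappa> y mod 3" if "x \<in> U" "y \<in> U" "adj G x y" for x y
    using that A[of x y] B[of x y] M[of x] M[of y] no_triangle[OF g free(1), of x z y]
    by (auto simp: \<kappa>_def adj_sym split: if_splits)
  note proper = this
  have "acyclic R"
    unfolding R_def
    by (rule cyclic_orientation_acyclic[OF g _ free(1,2,4)]) (use proper in \<open>auto simp: U_def\<close>)
  then obtain \<rho> where \<rho>: "\<And>v. 0 \<le> \<rho> v \<and> \<rho> v \<le> int (card (verts G))"
    and mono: "\<And>x y. (x, y) \<in> R \<Longrightarrow> \<rho> x < \<rho> y"
    by (rule rank_of_acyclic[OF fin]) (auto simp: R_def U_def)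
  \<comment> \<open>Ranks are at most \<open>k - 2\<close>, so class 2 stays below \<open>3 * k - 1\<close> and the other bounds on edges are automatic.\<close>
  define k where "k = int (card (verts G)) + 2"
  define c where "c v = (if v = z then 0 else int (\<kappa> v) * k + \<rho> v)" for v
  have c0: "c z = 0" by (simp add: c_def)
  have edge: "k \<le> \<bar>c u - c v\<bar> \<and> \<bar>c u - c v\<bar> \<le> 2 * k - 1" if uv: "(u, v) \<in> R" for u v
  proof -
    have "u \<noteq> z" "v \<noteq> z" "\<kappa> v mod 3 = (\<kappa> u + 1) mod 3" using uv by (auto simp: R_def U_def)
    moreover have "\<kappa> u \<le> 2" "\<kappa> v \<le> 2" by (auto simp: \<kappa>_def)
    ultimately consider "\<kappa> u = 0" "\<kappa> v = 1" | "\<kappa> u = 1" "\<kappa> v = 2" | "\<kappa> u = 2" "\<kappa> v = 0"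
      by (auto simp: le_Suc_eq numeral_2_eq_2)
    then show ?thesis
      using mono[OF uv] \<rho>[of u] \<rho>[of v] \<open>u \<noteq> z\<close> \<open>v \<noteq> z\<close>
      by cases (auto simp: c_def k_def)
  qed
  have edge_z: "k \<le> \<bar>c z - c v\<bar> \<and> \<bar>c z - c v\<bar> \<le> 2 * k - 1" if "adj G z v" for v
  proof -
    have "v \<noteq> z" "v \<notin> A" "v \<notin> B" using that AB(2) adj_irrefl[OF g] by auto
    then show ?thesis using \<rho>[of v] by (auto simp: c_def k_def \<kappa>_def)
  qed
  have "andrasfai_colouring k c G"
    unfolding andrasfai_colouring_def
  proof (intro conjI ballI allI impI)
    show "k \<ge> 1" by (simp add: k_def)
    show "0 \<le> c v" "c v < 3 * k - 1" for v
      using \<rho>[of v] by (auto simp: c_def k_def \<kappa>_def)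
    fix u v assume uv: "adj G u v"
    have "k \<le> \<bar>c u - c v\<bar> \<and> \<bar>c u - c v\<bar> \<le> 2 * k - 1"
    proof (cases "u = z \<or> v = z")
      case True
      then show ?thesis using edge_z[of u] edge_z[of v] uv by (auto simp: adj_sym abs_minus_commute)
    next
      case False
      then have UU: "u \<in> U" "v \<in> U" using uv adjD[OF g] by (auto simp: U_def)
      have "\<kappa> v mod 3 = (\<kappa> u + 1) mod 3 \<or> \<kappa> u mod 3 = (\<kappa> v + 1) mod 3"
        using proper[OF UU uv] by (auto simp: \<kappa>_def split: if_splits)
      then have "(u, v) \<in> R \<or> (v, u) \<in> R" using UU uv by (auto simp: R_def adj_sym)
      then show ?thesis using edge by (metis abs_minus_commute)
    qed
    then show "k \<le> \<bar>c u - c v\<bar>" "\<bar>c u - c v\<bar> \<le> 2 * k - 1" by auto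
  qed
  then show ?thesis by blast
qed

section \<open>Maximal triangle-free graphs without induced hexagons\<close>

text \<open>A single new edge \<open>u v\<close> creates a triangle exactly if \<open>u\<close> and \<open>v\<close> have a common neighbour.\<close>

lemma maximal_triangle_free_iff:
  "maximal_triangle_free G \<longleftrightarrow> is_graph G \<and> free_of K\<^sub>3 G \<and>
     (\<forall>u\<in>verts G. \<forall>v\<in>verts G. u \<noteq> v \<longrightarrow> \<not> adj G u v \<longrightarrow> (\<exists>w. adj G w u \<and> adj G w v))"
  (is "_ \<longleftrightarrow> _ \<and> _ \<and> ?N")
proof (intro iffI conjI)
  assume max: "maximal_triangle_free G"
  then show g: "is_graph G" and free: "free_of K\<^sub>3 G" by (auto simp: maximal_triangle_free_def)
  show ?N
  proof (intro ballI impI, rule ccontr)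
    fix u v assume uv: "u \<in> verts G" "v \<in> verts G" "u \<noteq> v" "\<not> adj G u v"
      and no: "\<not> (\<exists>w. adj G w u \<and> adj G w v)"
    define G' where "G' = \<lparr>verts = verts G, edges = insert {u, v} (edges G)\<rparr>"
    have adj': "adj G' a b \<longleftrightarrow> adj G a b \<or> a = u \<and> b = v \<or> a = v \<and> b = u" for a b
      by (auto simp: G'_def adj_def doubleton_eq_iff)
    have g': "is_graph G'" using g uv unfolding is_graph_def G'_def by auto
    have "free_of K\<^sub>3 G'"
      unfolding free_of_K3_iff[OF g']
      using no_triangle[OF g free] no uv adj_swap[of G] adj_irrefl[OF g]
      unfolding adj' by (metis (no_types))
    moreover have "extends_to G G'" "edges G' \<noteq> edges G"
      using g' uv by (auto simp: extends_to_def G'_def adj_def)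
    ultimately show False using max by (auto simp: maximal_triangle_free_def)
  qed
next
  assume *: "is_graph G \<and> free_of K\<^sub>3 G \<and> ?N"
  show "maximal_triangle_free G"
    unfolding maximal_triangle_free_def
  proof (intro conjI allI impI notI)
    show "is_graph G" "free_of K\<^sub>3 G" using * by auto
    fix G' assume G': "extends_to G G' \<and> edges G' \<noteq> edges G" and free: "free_of K\<^sub>3 G'"
    then have g': "is_graph G'" "verts G' = verts G" "edges G \<subseteq> edges G'"
      by (auto simp: extends_to_def)
    with G' obtain e where "e \<in> edges G'" "e \<notin> edges G" by blast
    with g' obtain u v where uv: "u \<in> verts G" "v \<in> verts G" "u \<noteq> v" "adj G' u v" "\<not> adj G u v"
      unfolding is_graph_def adj_def by metis
    with * obtain w where "adj G w u" "adj G w v" by blast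
    with g' have "adj G' u w" "adj G' w v" by (auto simp: adj_def insert_commute)
    with no_triangle[OF g'(1) free] uv show False by blast
  qed
qed

text \<open>Common neighbours of the three pairs among \<open>x\<close>, \<open>y\<close>, \<open>z\<close> form an induced hexagon together with
  \<open>x\<close>, \<open>y\<close>, \<open>z\<close>, unless one of them is adjacent to all three.\<close>

lemma common_neighbour_of_three:
  assumes max: "maximal_triangle_free G" and free: "free_of C\<^sub>6 G"
    and "x \<in> verts G" "y \<in> verts G" "z \<in> verts G" "x \<noteq> y" "y \<noteq> z" "x \<noteq> z"
    and ind: "\<not> adj G x y" "\<not> adj G y z" "\<not> adj G x z"
  obtains w where "adj G w x" "adj G w y" "adj G w z"
proof -
  have g: "is_graph G" and "free_of K\<^sub>3 G" using max by (auto simp: maximal_triangle_free_iff)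
  note tri = no_triangle[OF this]
  obtain p q r where pqr: "adj G p x" "adj G p y" "adj G q y" "adj G q z" "adj G r z" "adj G r x"
    using max assms(3-11) unfolding maximal_triangle_free_iff by metis
  have "\<not> (\<not> adj G p z \<and> \<not> adj G q x \<and> \<not> adj G r y)"
  proof
    assume *: "\<not> adj G p z \<and> \<not> adj G q x \<and> \<not> adj G r y"
    have "\<not> adj G p q" "\<not> adj G q r" "\<not> adj G r p"
      using tri pqr adj_swap by metis+
    with * pqr ind show False
      by (intro no_C6[OF g free, of x p y q z r]) (simp_all add: adj_sym)
  qed
  then show ?thesis using pqr that by blast
qed

text \<open>Both patterns are destroyed by common neighbours of independent triples. In \<open>K\<^sub>1 + 2K\<^sub>2\<close> with isolated
  vertex \<open>w\<close>, common neighbours \<open>r\<close> of \<open>w, b, c\<close> and \<open>q\<close> of \<open>w, a, d\<close> give the induced hexagon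
  \<open>a b r c d q\<close>, where \<open>r\<close> and \<open>q\<close> are not adjacent because \<open>w\<close> is adjacent to both. In \<open>K\<^sub>1 + C\<^sub>5\<close>, a common
  neighbour \<open>y\<close> of \<open>w, a, c\<close> yields \<open>K\<^sub>1 + 2K\<^sub>2\<close> on \<open>b\<close>, \<open>w y\<close> and \<open>d f\<close>.\<close>

lemma free_if_maximal_triangle_free:
  assumes max: "maximal_triangle_free G" and free: "free_of C\<^sub>6 G"
  shows "free_of K1_plus_2K2 G" "free_of K1_plus_C5 G"
proof -
  have g: "is_graph G" and "free_of K\<^sub>3 G" using max by (auto simp: maximal_triangle_free_iff)
  note tri = no_triangle[OF this]
  note v = adjD[OF g]
  show 1: "free_of K1_plus_2K2 G"
    unfolding free_of_K1_plus_2K2_iff[OF g]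
  proof clarify
    fix w a b c d assume e: "w \<in> verts G" "adj G a b" "adj G c d"
      and n: "\<not> adj G w a" "\<not> adj G w b" "\<not> adj G w c" "\<not> adj G w d"
        "\<not> adj G a c" "\<not> adj G a d" "\<not> adj G b c" "\<not> adj G b d"
    have neq: "w \<noteq> a" "w \<noteq> b" "w \<noteq> c" "w \<noteq> d" "b \<noteq> c" "a \<noteq> d"
      using e n adj_swap by metis+
    obtain r where r: "adj G r w" "adj G r b" "adj G r c"
      using common_neighbour_of_three[OF max free, of w b c] e n neq v by metis
    obtain q where q: "adj G q w" "adj G q a" "adj G q d"
      using common_neighbour_of_three[OF max free, of w a d] e n neq v by metis
    have "\<not> adj G a r" "\<not> adj G b q" "\<not> adj G r d" "\<not> adj G c q" "\<not> adj G r q"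
      using tri e r q adj_swap by metis+
    with e n r q show False
      by (intro no_C6[OF g free, of a b r c d q]) (simp_all add: adj_sym)
  qed
  show "free_of K1_plus_C5 G"
    unfolding free_of_K1_plus_C5_iff[OF g]
  proof clarify
    fix w a b c d f assume e: "w \<in> verts G" "adj G a b" "adj G b c" "adj G c d" "adj G d f" "adj G f a"
      and n: "\<not> adj G w a" "\<not> adj G w b" "\<not> adj G w c" "\<not> adj G w d" "\<not> adj G w f"
        "\<not> adj G a c" "\<not> adj G b d" "\<not> adj G c f" "\<not> adj G d a" "\<not> adj G f b"
    have neq: "w \<noteq> a" "w \<noteq> c" "a \<noteq> c" using e n adj_swap by metis+
    obtain y where y: "adj G y w" "adj G y a" "adj G y c"
      using common_neighbour_of_three[OF max free, of w a c] e n neq v by metis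
    have *: "\<not> adj G b y" "\<not> adj G y d" "\<not> adj G y f"
      using tri e y adj_swap by metis+
    have "\<not> adj G b w" "\<not> adj G b f" using n adj_swap by metis+
    then show False
      using no_K1_plus_2K2[OF g 1, of b w y d f] e n y * v adj_swap by metis
  qed
qed

section \<open>The Petersen graph minus a vertex\<close>

text \<open>The first six vertices form a hexagon in this order; the last three are the former neighbours of the
  deleted vertex, and each is adjacent to two opposite vertices of the hexagon.\<close>

lemma verts_petersen_minus_vertex:
  "verts petersen_minus_vertex =
    set [{0, 2}, {1, 3}, {0, 4}, {1, 2}, {0, 3}, {1, 4}, {3, 4}, {2, 4}, {2, 3}]" (is "_ = ?V")
proof
  show "verts petersen_minus_vertex \<subseteq> ?V"
  proof
    fix A assume A: "A \<in> verts petersen_minus_vertex"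
    then have "A \<subseteq> {..<5}" "card A = 2" "A \<noteq> {0, 1}"
      by (auto simp: petersen_minus_vertex_def delete_vertex_def induced_def petersen_def Let_def)
    moreover from this(2) obtain x y where "A = {x, y}" "x \<noteq> y"
      using card_2_iff by metis
    ultimately have A: "A = {x, y}" "x \<noteq> y" "x < 5" "y < 5" "A \<noteq> {0, 1}" by auto
    then have "x = 0 \<or> x = 1 \<or> x = 2 \<or> x = 3 \<or> x = 4" "y = 0 \<or> y = 1 \<or> y = 2 \<or> y = 3 \<or> y = 4"
      by auto
    with A show "A \<in> ?V"
      by (elim disjE) (simp_all add: insert_commute)
  qed
  show "?V \<subseteq> verts petersen_minus_vertex"
    by (auto simp: petersen_minus_vertex_def delete_vertex_def induced_def petersen_def Let_def
        doubleton_eq_iff)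
qed

lemma adj_petersen_minus_vertex:
  "adj petersen_minus_vertex A B \<longleftrightarrow>
     A \<in> verts petersen_minus_vertex \<and> B \<in> verts petersen_minus_vertex \<and> A \<inter> B = {}"
  unfolding petersen_minus_vertex_def delete_vertex_def adj_induced
  by (auto simp: adj_def petersen_def Let_def doubleton_eq_iff)

lemma is_graph_petersen_minus_vertex: "is_graph petersen_minus_vertex"
  unfolding is_graph_def
proof (intro conjI ballI)
  show "verts petersen_minus_vertex \<noteq> {}" by (simp add: verts_petersen_minus_vertex)
  fix e assume e: "e \<in> edges petersen_minus_vertex"
  then obtain A B where AB: "e = {A, B}"
    by (auto simp: petersen_minus_vertex_def delete_vertex_def induced_def petersen_def Let_def)
  with e have *: "A \<in> verts petersen_minus_vertex" "B \<in> verts petersen_minus_vertex" "A \<inter> B = {}"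
    using adj_petersen_minus_vertex[of A B] by (auto simp: adj_def)
  moreover have "{} \<notin> verts petersen_minus_vertex" by (simp add: verts_petersen_minus_vertex)
  ultimately have "A \<noteq> B" by auto
  with AB * show "\<exists>x\<in>verts petersen_minus_vertex. \<exists>y\<in>verts petersen_minus_vertex. x \<noteq> y \<and> e = {x, y}"
    by blast
qed

text \<open>In a copy of the Petersen graph minus a vertex the hexagon is induced, because every chord would
  complete a triangle: a short chord with a vertex of the hexagon, a long one with one of the three
  further vertices. Conversely, opposite vertices of an induced hexagon have common neighbours by
  maximality. No vertex serves two of the opposite pairs without creating a triangle, and so these
  neighbours are three further vertices.\<close>

lemma contains_petersen_minus_vertex_iff:
  assumes max: "maximal_triangle_free G"
  shows "contains_subgraph G petersen_minus_vertex \<longleftrightarrow> \<not> free_of C\<^sub>6 G"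
proof
  have g: "is_graph G" and "free_of K\<^sub>3 G" using max by (auto simp: maximal_triangle_free_iff)
  note tri = no_triangle[OF this]
  show "\<not> free_of C\<^sub>6 G" if "contains_subgraph G petersen_minus_vertex"
  proof -
    from that obtain f where "\<forall>A\<in>verts petersen_minus_vertex. \<forall>B\<in>verts petersen_minus_vertex.
        adj petersen_minus_vertex A B \<longrightarrow> adj G (f A) (f B)"
      unfolding contains_subgraph_iff[OF is_graph_petersen_minus_vertex g] by (elim exE conjE)
    then have f: "adj G (f A) (f B)" if "adj petersen_minus_vertex A B" for A B
      using adjD[OF is_graph_petersen_minus_vertex that] that by simp
    define x where "x i j = f {i, j}" for i j :: nat
    have e: "adj G (x i j) (x k l)"
      if "{i, j} \<in> verts petersen_minus_vertex" "{k, l} \<in> verts petersen_minus_vertex"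
        "{i, j} \<inter> {k, l} = {}" for i j k l
      using f that unfolding x_def adj_petersen_minus_vertex by blast
    have hex: "adj G (x 0 2) (x 1 3)" "adj G (x 1 3) (x 0 4)" "adj G (x 0 4) (x 1 2)"
      "adj G (x 1 2) (x 0 3)" "adj G (x 0 3) (x 1 4)" "adj G (x 1 4) (x 0 2)"
      by (rule e; simp add: verts_petersen_minus_vertex)+
    have spokes: "adj G (x 0 2) (x 3 4)" "adj G (x 3 4) (x 1 2)" "adj G (x 1 3) (x 2 4)"
      "adj G (x 2 4) (x 0 3)" "adj G (x 0 4) (x 2 3)" "adj G (x 2 3) (x 1 4)"
      by (rule e; simp add: verts_petersen_minus_vertex)+
    show ?thesis
    proof
      assume "free_of C\<^sub>6 G"
      then show False
        by (rule no_C6[OF g _ hex tri[OF hex(1,2)] tri[OF hex(2,3)] tri[OF hex(3,4)]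
          tri[OF hex(4,5)] tri[OF hex(5,6)] tri[OF hex(6,1)]
          tri[OF spokes(1,2)] tri[OF spokes(3,4)] tri[OF spokes(5,6)]])
    qed
  qed
  show "contains_subgraph G petersen_minus_vertex" if "\<not> free_of C\<^sub>6 G"
  proof -
    from that obtain a b c d e f where
      hex: "adj G a b" "adj G b c" "adj G c d" "adj G d e" "adj G e f" "adj G f a"
      and n: "\<not> adj G a c" "\<not> adj G b d" "\<not> adj G c e" "\<not> adj G d f" "\<not> adj G e a" "\<not> adj G f b"
        "\<not> adj G a d" "\<not> adj G b e" "\<not> adj G c f"
      unfolding free_of_C6_iff[OF g] by blast
    have v: "a \<in> verts G" "b \<in> verts G" "c \<in> verts G" "d \<in> verts G" "e \<in> verts G" "f \<in> verts G"
      using hex adjD[OF g] by blast+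
    have s: "adj G b a" "adj G c b" "adj G d c" "adj G e d" "adj G f e" "adj G a f"
      "\<not> adj G c a" "\<not> adj G d b" "\<not> adj G e c" "\<not> adj G f d" "\<not> adj G a e" "\<not> adj G b f"
      "\<not> adj G d a" "\<not> adj G e b" "\<not> adj G f c"
      using hex n by (simp_all add: adj_sym)
    have neq: "a \<noteq> b" "a \<noteq> c" "a \<noteq> d" "a \<noteq> e" "a \<noteq> f" "b \<noteq> c" "b \<noteq> d" "b \<noteq> e" "b \<noteq> f"
      "c \<noteq> d" "c \<noteq> e" "c \<noteq> f" "d \<noteq> e" "d \<noteq> f" "e \<noteq> f"
      using hex n s adj_irrefl[OF g] by auto
    obtain p q r where pqr: "adj G p a" "adj G p d" "adj G q b" "adj G q e" "adj G r c" "adj G r f"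
      using max v n(7-9) neq(3,8,12) unfolding maximal_triangle_free_iff by metis
    have v': "p \<in> verts G" "q \<in> verts G" "r \<in> verts G"
      using pqr adjD[OF g] by blast+
    have s': "adj G a p" "adj G d p" "adj G b q" "adj G e q" "adj G c r" "adj G f r"
      using pqr by (simp_all add: adj_sym)
    have "a \<noteq> p" "b \<noteq> p" "c \<noteq> p" "d \<noteq> p" "e \<noteq> p" "f \<noteq> p"
      "a \<noteq> q" "b \<noteq> q" "c \<noteq> q" "d \<noteq> q" "e \<noteq> q" "f \<noteq> q"
      "a \<noteq> r" "b \<noteq> r" "c \<noteq> r" "d \<noteq> r" "e \<noteq> r" "f \<noteq> r"
      using pqr s' n s adj_irrefl[OF g] by auto
    moreover have "p \<noteq> q" "p \<noteq> r" "q \<noteq> r"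
      using tri[of p a b] tri[of p d c] tri[of q b c] hex pqr s by auto
    ultimately show ?thesis
      by (intro subgraph_by_lists[OF g _ is_graph_petersen_minus_vertex verts_petersen_minus_vertex,
            of "[a, b, c, d, e, f, p, q, r]"])
        (use v v' neq hex s pqr s' in
          \<open>simp_all add: adj_petersen_minus_vertex doubleton_eq_iff verts_petersen_minus_vertex\<close>)
  qed
qed

section \<open>Points on a circle\<close>

text \<open>For \<open>s\<close> and \<open>t\<close> in \<open>{0..<L}\<close>, viewed as points of a circle of length \<open>L\<close>: both arcs between them are
  longer than 1.\<close>

definition far_apart :: "real \<Rightarrow> real \<Rightarrow> real \<Rightarrow> bool" where
  "far_apart L s t \<longleftrightarrow> 1 < \<bar>s - t\<bar> \<and> \<bar>s - t\<bar> < L - 1"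

definition circle_graph :: "'a set \<Rightarrow> real \<Rightarrow> ('a \<Rightarrow> real) \<Rightarrow> 'a graph" where
  "circle_graph V L s = \<lparr>verts = V, edges = {{u, v} | u v. u \<in> V \<and> v \<in> V \<and> far_apart L (s u) (s v)}\<rparr>"

lemma far_apart_sym: "far_apart L s t \<longleftrightarrow> far_apart L t s"
  by (simp add: far_apart_def abs_minus_commute)

lemma adj_circle_graph: "adj (circle_graph V L s) u v \<longleftrightarrow> u \<in> V \<and> v \<in> V \<and> far_apart L (s u) (s v)"
  by (auto simp: adj_def circle_graph_def doubleton_eq_iff far_apart_sym)

lemma verts_circle_graph: "verts (circle_graph V L s) = V"
  by (simp add: circle_graph_def)

lemma is_graph_circle_graph: "V \<noteq> {} \<Longrightarrow> is_graph (circle_graph V L s)"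
  unfolding is_graph_def circle_graph_def by (force simp: far_apart_def)

text \<open>The points within distance 1 of \<open>w\<close> lie on an arc of length 2. As \<open>L > 3\<close>, the way around the rest of
  the circle is longer than 1, so distances between such points can be measured on the real line.\<close>

lemma local_coordinate:
  fixes L w :: real
  assumes "L > 3" "0 \<le> w" "w < L"
  obtains y :: "real \<Rightarrow> real" where "\<forall>s. 0 \<le> s \<and> s < L \<and> \<not> far_apart L w s \<longrightarrow> \<bar>y s\<bar> \<le> 1"
    "\<forall>s t. 0 \<le> s \<and> s < L \<and> 0 \<le> t \<and> t < L \<and> \<bar>y s\<bar> \<le> 1 \<and> \<bar>y t\<bar> \<le> 1 \<longrightarrow>
      (far_apart L s t \<longleftrightarrow> \<bar>y s - y t\<bar> > 1)"
proof
  let ?y = "\<lambda>s. if s - w > 1 then s - w - L else if s - w < - 1 then s - w + L else s - w"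
  show "\<forall>s. 0 \<le> s \<and> s < L \<and> \<not> far_apart L w s \<longrightarrow> \<bar>?y s\<bar> \<le> 1"
    using assms by (auto simp: far_apart_def split: if_splits)
  show "\<forall>s t. 0 \<le> s \<and> s < L \<and> 0 \<le> t \<and> t < L \<and> \<bar>?y s\<bar> \<le> 1 \<and> \<bar>?y t\<bar> \<le> 1 \<longrightarrow>
      (far_apart L s t \<longleftrightarrow> \<bar>?y s - ?y t\<bar> > 1)"
    using assms by (auto simp: far_apart_def split: if_splits)
qed

text \<open>In the coordinate around \<open>w\<close>, which lies in \<open>{-1..1}\<close>, both far pairs straddle 0, and so they cross:
  the two positive points cannot both be close to both of the negative ones.\<close>

lemma far_apart_no_K1_plus_2K2:
  fixes L :: real
  assumes "L > 3" and I: "\<forall>x\<in>{w, a, b, c, d}. 0 \<le> x \<and> x < L"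
    and e: "far_apart L a b" "far_apart L c d"
    and n: "\<not> far_apart L w a" "\<not> far_apart L w b" "\<not> far_apart L w c" "\<not> far_apart L w d"
      "\<not> far_apart L a c" "\<not> far_apart L a d" "\<not> far_apart L b c" "\<not> far_apart L b d"
  shows False
proof -
  have w: "0 \<le> w" "w < L" using I by auto
  obtain y :: "real \<Rightarrow> real" where y: "\<forall>s. 0 \<le> s \<and> s < L \<and> \<not> far_apart L w s \<longrightarrow> \<bar>y s\<bar> \<le> 1"
    "\<forall>s t. 0 \<le> s \<and> s < L \<and> 0 \<le> t \<and> t < L \<and> \<bar>y s\<bar> \<le> 1 \<and> \<bar>y t\<bar> \<le> 1 \<longrightarrow>
      (far_apart L s t \<longleftrightarrow> \<bar>y s - y t\<bar> > 1)"
    by (rule local_coordinate[OF assms(1) w])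
  have near: "\<bar>y x\<bar> \<le> 1" if "x \<in> {w, a, b, c, d}" "\<not> far_apart L w x" for x
    using y(1) I that by blast
  have gap: "far_apart L x z \<longleftrightarrow> \<bar>y x - y z\<bar> > 1"
    if "x \<in> {w, a, b, c, d}" "z \<in> {w, a, b, c, d}" "\<bar>y x\<bar> \<le> 1" "\<bar>y z\<bar> \<le> 1" for x z
    using y(2) I that by blast
  have b: "\<bar>y a\<bar> \<le> 1" "\<bar>y b\<bar> \<le> 1" "\<bar>y c\<bar> \<le> 1" "\<bar>y d\<bar> \<le> 1"
    using n near[of a] near[of b] near[of c] near[of d] by blast+
  have "\<bar>y a - y b\<bar> > 1" "\<bar>y c - y d\<bar> > 1" "\<not> \<bar>y a - y c\<bar> > 1"
    "\<not> \<bar>y a - y d\<bar> > 1" "\<not> \<bar>y b - y c\<bar> > 1" "\<not> \<bar>y b - y d\<bar> > 1"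
    using e n b gap[of a b] gap[of c d] gap[of a c] gap[of a d] gap[of b c] gap[of b d]
    by blast+
  with b show False by (smt (verit))
qed

text \<open>Around \<open>w\<close>, far points have coordinates of opposite signs, which is impossible along an odd cycle.\<close>

lemma far_apart_no_K1_plus_C5:
  fixes L :: real
  assumes "L > 3" and I: "\<forall>x\<in>{w, a, b, c, d, e}. 0 \<le> x \<and> x < L"
    and e: "far_apart L a b" "far_apart L b c" "far_apart L c d" "far_apart L d e" "far_apart L e a"
    and n: "\<not> far_apart L w a" "\<not> far_apart L w b" "\<not> far_apart L w c" "\<not> far_apart L w d"
      "\<not> far_apart L w e"
  shows False
proof -
  have w: "0 \<le> w" "w < L" using I by auto
  obtain y :: "real \<Rightarrow> real" where y: "\<forall>s. 0 \<le> s \<and> s < L \<and> \<not> far_apart L w s \<longrightarrow> \<bar>y s\<bar> \<le> 1"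
    "\<forall>s t. 0 \<le> s \<and> s < L \<and> 0 \<le> t \<and> t < L \<and> \<bar>y s\<bar> \<le> 1 \<and> \<bar>y t\<bar> \<le> 1 \<longrightarrow>
      (far_apart L s t \<longleftrightarrow> \<bar>y s - y t\<bar> > 1)"
    by (rule local_coordinate[OF assms(1) w])
  have near: "\<bar>y x\<bar> \<le> 1" if "x \<in> {w, a, b, c, d, e}" "\<not> far_apart L w x" for x
    using y(1) I that by blast
  have gap: "far_apart L x z \<longleftrightarrow> \<bar>y x - y z\<bar> > 1"
    if "x \<in> {w, a, b, c, d, e}" "z \<in> {w, a, b, c, d, e}" "\<bar>y x\<bar> \<le> 1" "\<bar>y z\<bar> \<le> 1" for x z
    using y(2) I that by blast
  have b: "\<bar>y a\<bar> \<le> 1" "\<bar>y b\<bar> \<le> 1" "\<bar>y c\<bar> \<le> 1" "\<bar>y d\<bar> \<le> 1" "\<bar>y e\<bar> \<le> 1"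
    using n near[of a] near[of b] near[of c] near[of d] near[of e] by blast+
  have "\<bar>y a - y b\<bar> > 1" "\<bar>y b - y c\<bar> > 1" "\<bar>y c - y d\<bar> > 1" "\<bar>y d - y e\<bar> > 1" "\<bar>y e - y a\<bar> > 1"
    using e n b gap[of a b] gap[of b c] gap[of c d] gap[of d e] gap[of e a]
    by blast+
  with b show False by (smt (verit))
qed

text \<open>Three points that are pairwise close lie on an arc of length 1, because \<open>L > 3\<close>. Of \<open>a\<close>, \<open>c\<close>, \<open>e\<close> one is
  therefore between the other two, and is far from every point that is far from these two. But each
  two of \<open>a\<close>, \<open>c\<close>, \<open>e\<close> have a common far point in the hexagon that is close to the third.\<close>

lemma far_apart_no_C6:
  fixes L :: real
  assumes "L > 3" and I: "\<forall>x\<in>{a, b, c, d, e, f}. 0 \<le> x \<and> x < L"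
    and e: "far_apart L a b" "far_apart L b c" "far_apart L c d" "far_apart L d e" "far_apart L e f"
      "far_apart L f a"
    and n: "\<not> far_apart L a c" "\<not> far_apart L c e" "\<not> far_apart L e a"
      "\<not> far_apart L a d" "\<not> far_apart L b e" "\<not> far_apart L c f"
  shows False
  using assms unfolding far_apart_def by (smt (verit) insertCI)

lemma circle_graph_free:
  assumes "V \<noteq> {}" "L > 3" and s: "\<And>v. v \<in> V \<Longrightarrow> 0 \<le> s v \<and> s v < L"
  shows "free_of K1_plus_2K2 (circle_graph V L s)" "free_of K1_plus_C5 (circle_graph V L s)"
    "free_of C\<^sub>6 (circle_graph V L s)"
proof -
  note g = is_graph_circle_graph[OF assms(1), of L s]
  show "free_of K1_plus_2K2 (circle_graph V L s)"
    unfolding free_of_K1_plus_2K2_iff[OF g] adj_circle_graph verts_circle_graph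
    apply clarify
    subgoal for w a b c d
      using far_apart_no_K1_plus_2K2[OF assms(2), of "s w" "s a" "s b" "s c" "s d"] s by blast
    done
  show "free_of K1_plus_C5 (circle_graph V L s)"
    unfolding free_of_K1_plus_C5_iff[OF g] adj_circle_graph verts_circle_graph
    apply clarify
    subgoal for w a b c d e
      using far_apart_no_K1_plus_C5[OF assms(2), of "s w" "s a" "s b" "s c" "s d" "s e"] s by blast
    done
  show "free_of C\<^sub>6 (circle_graph V L s)"
    unfolding free_of_C6_iff[OF g] adj_circle_graph verts_circle_graph
    apply clarify
    subgoal for a b c d e f
      using far_apart_no_C6[OF assms(2), of "s a" "s b" "s c" "s d" "s e" "s f"] s by blast
    done
qed

section \<open>From colourings to maximal triangle-free graphs\<close>

text \<open>Cyclic rotation moves the unused colour \<open>j\<close> to 0.\<close>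

lemma rotate_andrasfai_colouring:
  assumes c: "andrasfai_colouring k c G" and j: "0 \<le> j" "j < 3 * k - 1" "j \<notin> c ` verts G"
  obtains c' where "andrasfai_colouring k c' G" "\<forall>v\<in>verts G. c' v \<noteq> 0"
proof
  let ?c = "\<lambda>v. if c v > j then c v - j else c v - j + (3 * k - 1)"
  show "\<forall>v\<in>verts G. ?c v \<noteq> 0"
    using c j by (auto simp: andrasfai_colouring_def)
  show "andrasfai_colouring k ?c G"
    unfolding andrasfai_colouring_def
  proof (intro conjI ballI allI impI)
    show "1 \<le> k" using c by (simp add: andrasfai_colouring_def)
    fix v assume v: "v \<in> verts G"
    then have "c v \<noteq> j" "0 \<le> c v" "c v < 3 * k - 1" using c j by (auto simp: andrasfai_colouring_def)
    then show "0 \<le> ?c v" "?c v < 3 * k - 1" using j by auto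
  next
    fix u v assume uv: "adj G u v"
    then have "k \<le> \<bar>c u - c v\<bar>" "\<bar>c u - c v\<bar> \<le> 2 * k - 1"
      using c by (auto simp: andrasfai_colouring_def)
    then show "k \<le> \<bar>?c u - ?c v\<bar>" "\<bar>?c u - ?c v\<bar> \<le> 2 * k - 1"
      by auto
  qed
qed

text \<open>Without the vertex 0, the vertex \<open>k\<close> of the Andrasfai graph is dominated by \<open>k - 1\<close>, and \<open>2 * k - 1\<close> by
  \<open>2 * k\<close>: their neighbourhoods lose the element 0 and are then contained in the other ones. Identifying
  the dominated vertices with the dominating ones leaves \<open>3 * k - 4\<close> vertices, which form the next smaller
  Andrasfai graph.\<close>

lemma compress_andrasfai_colouring:
  assumes c: "andrasfai_colouring k c G" "\<forall>v\<in>verts G. c v \<noteq> 0" and "k \<ge> 2"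
    and g: "is_graph G"
  obtains c' where "andrasfai_colouring (k - 1) c' G"
proof
  define f where "f = (\<lambda>i. if i < k then i - 1 else if i \<le> 2 * k - 2 then i - 2
    else if i = 2 * k - 1 then 2 * k - 3 else i - 3)"
  have range: "1 \<le> c v \<and> c v \<le> 3 * k - 2" if "v \<in> verts G" for v
    using c that by (force simp: andrasfai_colouring_def)
  have f: "k - 1 \<le> f i - f j \<and> f i - f j \<le> 2 * (k - 1) - 1"
    if "k \<le> i - j" "i - j \<le> 2 * k - 1" "1 \<le> i" "i \<le> 3 * k - 2" "1 \<le> j" "j \<le> 3 * k - 2" for i j
    using that assms(3) unfolding f_def by auto
  show "andrasfai_colouring (k - 1) (f \<circ> c) G"
    unfolding andrasfai_colouring_def
  proof (intro conjI ballI allI impI)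
    show "1 \<le> k - 1" using assms by simp
    show "0 \<le> (f \<circ> c) v" "(f \<circ> c) v < 3 * (k - 1) - 1" if "v \<in> verts G" for v
      using range[OF that] assms(3) by (auto simp: f_def)
    fix u v assume uv: "adj G u v"
    then have *: "k \<le> \<bar>c u - c v\<bar>" "\<bar>c u - c v\<bar> \<le> 2 * k - 1"
      using c by (auto simp: andrasfai_colouring_def)
    have "1 \<le> c u \<and> c u \<le> 3 * k - 2" "1 \<le> c v \<and> c v \<le> 3 * k - 2"
      using range adjD[OF g uv] by auto
    with * show "k - 1 \<le> \<bar>(f \<circ> c) u - (f \<circ> c) v\<bar>" "\<bar>(f \<circ> c) u - (f \<circ> c) v\<bar> \<le> 2 * (k - 1) - 1"
      using f[of "c u" "c v"] f[of "c v" "c u"] assms(3) by (auto simp: abs_if split: if_splits)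
  qed
qed

text \<open>The case \<open>k = 1\<close> has the two colours 0 and 1; if only one of them occurs, the graph has no edge and its at
  least two vertices can be coloured at will.\<close>

lemma surjective_andrasfai_colouring:
  assumes G: "finite_graph G" "card (verts G) \<ge> 2" and "andrasfai_colouring k c G"
  shows "\<exists>k c. andrasfai_colouring k c G \<and> c ` verts G = {0..<3 * k - 1}"
  using assms(3)
proof (induction "nat k" arbitrary: k c rule: less_induct)
  case less
  have g: "is_graph G" and k: "k \<ge> 1" using G less.prems by (auto simp: finite_graph_def andrasfai_colouring_def)
  have sub: "c ` verts G \<subseteq> {0..<3 * k - 1}" using less.prems by (auto simp: andrasfai_colouring_def)
  show ?case
  proof (cases "c ` verts G = {0..<3 * k - 1}")
    case True
    with less.prems show ?thesis by blast
  next
    case False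
    with sub obtain j where j: "0 \<le> j" "j < 3 * k - 1" "j \<notin> c ` verts G" by fastforce
    obtain c' where c': "andrasfai_colouring k c' G" "\<forall>v\<in>verts G. c' v \<noteq> 0"
      by (rule rotate_andrasfai_colouring[OF less.prems j])
    show ?thesis
    proof (cases "k = 1")
      case False
      with k have k2: "k \<ge> 2" by simp
      obtain c'' where "andrasfai_colouring (k - 1) c'' G"
        by (rule compress_andrasfai_colouring[OF c' k2 g])
      with less.hyps[of "k - 1" c''] k2 show ?thesis by simp
    next
      case True
      have no: "\<not> adj G u v" for u v
      proof
        assume uv: "adj G u v"
        then have "c' u = 1" "c' v = 1"
          using c' True adjD[OF g uv] by (force simp: andrasfai_colouring_def)+
        moreover have "k \<le> \<bar>c' u - c' v\<bar>" using c'(1) uv by (simp add: andrasfai_colouring_def)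
        ultimately show False using True by simp
      qed
      from G(2) obtain x y where xy: "x \<in> verts G" "y \<in> verts G" "x \<noteq> y"
        by (auto simp: numeral_2_eq_2 card_le_Suc_iff)
      define d :: "'a \<Rightarrow> int" where "d v = (if v = x then 0 else 1)" for v
      have "andrasfai_colouring 1 d G" using no by (auto simp: andrasfai_colouring_def d_def)
      moreover have "d ` verts G = {0, 1}" using xy by (auto simp: d_def)
      moreover have "{0..<3 * 1 - 1} = {0, 1::int}" by auto
      ultimately show ?thesis by metis
    qed
  qed
qed

lemma far_apart_scaled:
  fixes p i j m :: int
  assumes "m > 0"
  shows "far_apart (real_of_int p / m) (real_of_int i / m) (real_of_int j / m) \<longleftrightarrow>
    m < \<bar>i - j\<bar> \<and> \<bar>i - j\<bar> < p - m"
proof -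
  have "real_of_int i / m - real_of_int j / m = real_of_int (i - j) / m"
    by (simp add: diff_divide_distrib)
  then have d: "\<bar>real_of_int i / m - real_of_int j / m\<bar> = real_of_int \<bar>i - j\<bar> / m"
    using assms by simp
  have "1 < real_of_int \<bar>i - j\<bar> / m \<longleftrightarrow> real_of_int m < real_of_int \<bar>i - j\<bar>"
    using assms by (simp add: less_divide_eq)
  moreover have "real_of_int p / m - 1 = real_of_int (p - m) / m"
    using assms by (simp add: field_simps)
  then have "real_of_int \<bar>i - j\<bar> / m < real_of_int p / m - 1 \<longleftrightarrow> real_of_int \<bar>i - j\<bar> < real_of_int (p - m)"
    using assms by (simp only: divide_less_cancel) auto
  ultimately show ?thesis
    unfolding far_apart_def d of_int_less_iff by blast
qed

text \<open>The Andrasfai graph is a circle graph in the sense of \<open>far_apart\<close>: take \<open>k - 1 / 2\<close> as the unit of length on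
  a circle with \<open>3 * k - 1\<close> equidistant points. The circle is then longer than 3 units.\<close>

lemma far_apart_andrasfai:
  fixes k i j :: int
  assumes "k \<ge> 1"
  shows "far_apart (2 * (3 * k - 1) / (2 * k - 1)) (2 * i / (2 * k - 1)) (2 * j / (2 * k - 1)) \<longleftrightarrow>
    k \<le> \<bar>i - j\<bar> \<and> \<bar>i - j\<bar> \<le> 2 * k - 1"
  using far_apart_scaled[of "2 * k - 1" "2 * (3 * k - 1)" "2 * i" "2 * j"] assms by auto

lemma circumference_gt_3:
  fixes k :: int
  assumes "k \<ge> 1"
  shows "2 * (3 * real_of_int k - 1) / (2 * k - 1) > 3"
  using assms by (simp add: less_divide_eq)

text \<open>Two colours that are not adjacent lie on a short arc and have a common neighbour among the colours
  opposite to it; surjectivity of the colouring provides a vertex of that colour. A graph with only one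
  vertex has no surjective colouring, but is its own extension.\<close>

proposition maximal_extension_if_andrasfai:
  assumes G: "finite_graph G" and "andrasfai_colouring k0 c0 G"
  shows "\<exists>G'. extends_to G G' \<and> maximal_triangle_free G' \<and> free_of C\<^sub>6 G'"
proof (cases "card (verts G) \<ge> 2")
  case False
  have g: "is_graph G" using G by (simp add: finite_graph_def)
  have one: "u = v" if "u \<in> verts G" "v \<in> verts G" for u v
    using False that G card_le_Suc0_iff_eq[of "verts G"] by (auto simp: finite_graph_def)
  then have no: "\<not> adj G u v" for u v using adjD[OF g, of u v] by auto
  then have "maximal_triangle_free G" "free_of C\<^sub>6 G"
    using g one by (auto simp: maximal_triangle_free_iff free_of_K3_iff free_of_C6_iff)
  with g show ?thesis by (auto simp: extends_to_def)
next
  case True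
  obtain k c where c: "andrasfai_colouring k c G" and surj: "c ` verts G = {0..<3 * k - 1}"
    using surjective_andrasfai_colouring[OF G True assms(2)] by blast
  have g: "is_graph G" and ne: "verts G \<noteq> {}" using G by (auto simp: finite_graph_def is_graph_def)
  have k: "k \<ge> 1" and range: "\<And>v. v \<in> verts G \<Longrightarrow> 0 \<le> c v \<and> c v < 3 * k - 1"
    using c by (auto simp: andrasfai_colouring_def)
  have p: "2 * real_of_int k - 1 > 0" using k by simp
  define G' where "G' = circle_graph (verts G) (2 * (3 * k - 1) / (2 * k - 1)) (\<lambda>v. 2 * c v / (2 * k - 1))"
  have adj': "adj G' u v \<longleftrightarrow> u \<in> verts G \<and> v \<in> verts G \<and> k \<le> \<bar>c u - c v\<bar> \<and> \<bar>c u - c v\<bar> \<le> 2 * k - 1" for u v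
    unfolding G'_def adj_circle_graph using far_apart_andrasfai[OF k] by simp
  have g': "is_graph G'" unfolding G'_def by (rule is_graph_circle_graph[OF ne])
  have V': "verts G' = verts G" by (simp add: G'_def verts_circle_graph)
  have "edges G \<subseteq> edges G'"
  proof
    fix e assume e: "e \<in> edges G"
    with g obtain u v where "e = {u, v}" unfolding is_graph_def by blast
    with e have "adj G u v" by (simp add: adj_def)
    with c adjD[OF g] have "adj G' u v" by (simp add: adj' andrasfai_colouring_def)
    with \<open>e = {u, v}\<close> show "e \<in> edges G'" by (simp add: adj_def)
  qed
  moreover have "free_of C\<^sub>6 G'"
    unfolding G'_def
  proof (rule circle_graph_free(3)[OF ne])
    show "3 < real_of_int (2 * (3 * k - 1)) / real_of_int (2 * k - 1)"
      using circumference_gt_3[OF k] by simp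
    fix v assume "v \<in> verts G"
    with range have "0 \<le> real_of_int (c v)" "real_of_int (c v) < 3 * k - 1" by fastforce+
    then show "0 \<le> real_of_int (2 * c v) / real_of_int (2 * k - 1) \<and>
      real_of_int (2 * c v) / real_of_int (2 * k - 1) < real_of_int (2 * (3 * k - 1)) / real_of_int (2 * k - 1)"
      using p by (simp add: divide_less_cancel)
  qed
  moreover have "free_of K\<^sub>3 G'"
    unfolding free_of_K3_iff[OF g'] adj' using k by (smt (verit))
  moreover have "\<exists>w. adj G' w u \<and> adj G' w v"
    if uv: "u \<in> verts G" "v \<in> verts G" "\<not> adj G' u v" for u v
  proof -
    have "\<exists>w\<ge>0. w < 3 * k - 1 \<and> k \<le> \<bar>w - i\<bar> \<and> \<bar>w - i\<bar> \<le> 2 * k - 1 \<and> k \<le> \<bar>w - j\<bar> \<and> \<bar>w - j\<bar> \<le> 2 * k - 1"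
      if "0 \<le> i" "i \<le> j" "j < 3 * k - 1" "j - i < k \<or> j - i \<ge> 2 * k" for i j
    proof -
      \<comment> \<open>The witness lies \<open>k\<close> steps after the end of the short arc, reduced modulo \<open>3 * k - 1\<close>.\<close>
      from that have "j - i \<ge> 2 * k \<or> j - i < k \<and> j + k < 3 * k - 1 \<or> j - i < k \<and> j + k \<ge> 3 * k - 1"
        by linarith
      then consider "j - i \<ge> 2 * k" | "j - i < k" "j + k < 3 * k - 1" | "j - i < k" "j + k \<ge> 3 * k - 1"
        by blast
      then show ?thesis
      proof cases
        case 1 then show ?thesis using that k by (intro exI[of _ "i + k"]) auto
      next
        case 2 then show ?thesis using that k by (intro exI[of _ "j + k"]) auto
      next
        case 3 then show ?thesis using that k by (intro exI[of _ "j - 2 * k + 1"]) auto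
      qed
    qed
    note * = this
    have ij: "0 \<le> c u" "c u < 3 * k - 1" "0 \<le> c v" "c v < 3 * k - 1" using range uv by auto
    have "\<bar>c u - c v\<bar> < k \<or> \<bar>c u - c v\<bar> \<ge> 2 * k" using uv unfolding adj' by auto
    then obtain w where w: "0 \<le> w" "w < 3 * k - 1" "k \<le> \<bar>w - c u\<bar>" "\<bar>w - c u\<bar> \<le> 2 * k - 1"
      "k \<le> \<bar>w - c v\<bar>" "\<bar>w - c v\<bar> \<le> 2 * k - 1"
      using *[of "c u" "c v"] *[of "c v" "c u"] ij by (cases "c u \<le> c v") auto
    then obtain x where "x \<in> verts G" "c x = w"
      using surj by (metis atLeastLessThan_iff imageE)
    with w uv have "adj G' x u \<and> adj G' x v" by (simp add: adj')
    then show ?thesis by blast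
  qed
  ultimately have "extends_to G G' \<and> maximal_triangle_free G' \<and> free_of C\<^sub>6 G'"
    using g' V' by (simp add: extends_to_def maximal_triangle_free_iff)
  then show ?thesis by blast
qed

section \<open>Positions and arcs\<close>

text \<open>Circles of radius \<open>\<rho>\<close> are parametrised by arc length, with values in \<open>{0..<2 * pi * \<rho>}\<close>.\<close>

definition position :: "real \<Rightarrow> complex \<Rightarrow> real" where
  "position \<rho> x = \<rho> * Arg2pi x"

definition circle_point :: "real \<Rightarrow> real \<Rightarrow> complex" where
  "circle_point \<rho> s = \<rho> * cis (s / \<rho>)"

text \<open>The counterclockwise distance from \<open>s\<close> to \<open>t\<close> in this parametrisation of a circle of length \<open>L\<close>.\<close>

definition arc_distance :: "real \<Rightarrow> real \<Rightarrow> real \<Rightarrow> real" where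
  "arc_distance L s t = (if s \<le> t then t - s else t - s + L)"

lemma position_range:
  assumes "\<rho> > 0"
  shows "0 \<le> position \<rho> x" "position \<rho> x < 2 * pi * \<rho>"
  using assms Arg2pi_ge_0[of x] Arg2pi_lt_2pi[of x] by (auto simp: position_def mult.commute)

lemma arc_length_position:
  assumes "\<rho> > 0" "x \<in> sphere 0 \<rho>" "y \<in> sphere 0 \<rho>"
  shows "arc_length x y = arc_distance (2 * pi * \<rho>) (position \<rho> x) (position \<rho> y)"
proof -
  have n: "cmod x = \<rho>" "cmod y = \<rho>" "x \<noteq> 0" "y \<noteq> 0" using assms by auto
  then have "Arg2pi (y / x) = (if Arg2pi x \<le> Arg2pi y then Arg2pi y - Arg2pi x else Arg2pi y - Arg2pi x + 2 * pi)"
    using Arg2pi_diff[of y x] by (auto split: if_splits)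
  then show ?thesis
    using assms n by (auto simp: arc_length_def position_def arc_distance_def algebra_simps)
qed

lemma circle_point_in_sphere: "\<rho> > 0 \<Longrightarrow> circle_point \<rho> s \<in> sphere 0 \<rho>"
  by (simp add: circle_point_def norm_mult)

lemma position_circle_point:
  assumes "\<rho> > 0" "0 \<le> s" "s < 2 * pi * \<rho>"
  shows "position \<rho> (circle_point \<rho> s) = s"
proof -
  have "Arg2pi (circle_point \<rho> s) = s / \<rho>"
    by (rule Arg2pi_unique[of \<rho>]) (use assms in \<open>auto simp: circle_point_def cis_conv_exp field_simps\<close>)
  then show ?thesis using assms by (simp add: position_def)
qed

lemma arc_distance_gt_iff:
  assumes "0 \<le> l" "0 \<le> s" "s < L" "0 \<le> t" "t < L"
  shows "l < arc_distance L s t \<and> l < arc_distance L t s \<longleftrightarrow> l < \<bar>s - t\<bar> \<and> \<bar>s - t\<bar> < L - l"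
  using assms by (auto simp: arc_distance_def)

section \<open>Circular colourings\<close>

text \<open>Finitely many strict inequalities leave a common slack \<open>\<epsilon>\<close>. Rounding \<open>t v * (3 * k - 1)\<close> down changes a
  difference by less than 1, which is absorbed as soon as \<open>(3 * k - 1) * \<epsilon> \<ge> 4 / 3\<close>.\<close>

lemma andrasfai_colouring_if_angles:
  assumes G: "finite_graph G" and t: "\<And>v. v \<in> verts G \<Longrightarrow> 0 \<le> t v \<and> t v < (1::real)"
    and edge: "\<And>u v. adj G u v \<Longrightarrow> 1 / 3 < \<bar>t u - t v\<bar> \<and> \<bar>t u - t v\<bar> < 2 / 3"
  shows "\<exists>k c. andrasfai_colouring k c G"
proof -
  have g: "is_graph G" and fin: "finite (verts G)" using G by (auto simp: finite_graph_def)
  define E where "E = {(u, v). adj G u v}"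
  have "E \<subseteq> verts G \<times> verts G" using adjD[OF g] by (auto simp: E_def)
  then have finE: "finite E" using fin by (auto intro: finite_subset)
  define \<epsilon> where "\<epsilon> = Min (insert 1 ((\<lambda>(u, v). min (\<bar>t u - t v\<bar> - 1 / 3) (2 / 3 - \<bar>t u - t v\<bar>)) ` E))"
  have pos: "\<epsilon> > 0"
    unfolding \<epsilon>_def using finE edge by (auto simp: E_def)
  have \<epsilon>: "1 / 3 + \<epsilon> \<le> \<bar>t u - t v\<bar>" "\<bar>t u - t v\<bar> \<le> 2 / 3 - \<epsilon>" if "adj G u v" for u v
  proof -
    have "\<epsilon> \<le> min (\<bar>t u - t v\<bar> - 1 / 3) (2 / 3 - \<bar>t u - t v\<bar>)"
      unfolding \<epsilon>_def using finE that by (intro Min_le) (auto simp: E_def intro!: image_eqI[of _ _ "(u, v)"])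
    then show "1 / 3 + \<epsilon> \<le> \<bar>t u - t v\<bar>" "\<bar>t u - t v\<bar> \<le> 2 / 3 - \<epsilon>" by auto
  qed
  define k where "k = \<lceil>4 / (3 * \<epsilon>)\<rceil> + 1"
  have "0 < 4 / (3 * \<epsilon>)" using pos by simp
  then have "0 \<le> \<lceil>4 / (3 * \<epsilon>)\<rceil>" by linarith
  then have k: "k \<ge> 1" by (simp add: k_def)
  define P where "P = 3 * real_of_int k - 1"
  have "4 / (3 * \<epsilon>) \<le> real_of_int k" by (simp add: k_def) linarith
  also have "\<dots> \<le> P" using k by (simp add: P_def)
  finally have P\<epsilon>: "4 / 3 \<le> P * \<epsilon>" using pos by (simp add: field_simps)
  have P0: "P > 0" using k by (simp add: P_def)
  define c where "c v = \<lfloor>t v * P\<rfloor>" for v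
  have cv: "real_of_int (c v) \<le> t v * P" "t v * P < real_of_int (c v) + 1" for v
    by (auto simp: c_def)
  have "andrasfai_colouring k c G"
    unfolding andrasfai_colouring_def
  proof (intro conjI ballI allI impI)
    show "1 \<le> k" by (rule k)
    fix v assume v: "v \<in> verts G"
    show "0 \<le> c v" using t[OF v] P0 by (simp add: c_def)
    have "t v * P < P" using t[OF v] P0 by simp
    then have "real_of_int (c v) < real_of_int (3 * k - 1)" using cv(1)[of v] by (simp add: P_def)
    then show "c v < 3 * k - 1" by linarith
  next
    fix u v assume uv: "adj G u v"
    have d: "\<bar>t u * P - t v * P\<bar> = \<bar>t u - t v\<bar> * P"
      using P0 by (simp add: left_diff_distrib[symmetric] abs_mult)
    have "(1 / 3 + \<epsilon>) * P \<le> \<bar>t u * P - t v * P\<bar>" "\<bar>t u * P - t v * P\<bar> \<le> (2 / 3 - \<epsilon>) * P"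
      unfolding d using \<epsilon>[OF uv] P0 by (auto intro: mult_right_mono)
    moreover have "(1 / 3 + \<epsilon>) * P = real_of_int k - 1 / 3 + P * \<epsilon>"
      "(2 / 3 - \<epsilon>) * P = 2 * real_of_int k - 2 / 3 - P * \<epsilon>"
      by (auto simp: P_def algebra_simps)
    ultimately have "real_of_int k - 1 / 3 + P * \<epsilon> \<le> \<bar>t u * P - t v * P\<bar>"
      "\<bar>t u * P - t v * P\<bar> \<le> 2 * real_of_int k - 2 / 3 - P * \<epsilon>" by simp_all
    then have "real_of_int k + 1 \<le> \<bar>t u * P - t v * P\<bar>" "\<bar>t u * P - t v * P\<bar> \<le> 2 * real_of_int k - 2"
      using P\<epsilon> by linarith+
    then have "real_of_int k < \<bar>real_of_int (c u) - real_of_int (c v)\<bar>"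
      "\<bar>real_of_int (c u) - real_of_int (c v)\<bar> < 2 * real_of_int k - 1"
      using cv[of u] cv[of v] by linarith+
    then show "k \<le> \<bar>c u - c v\<bar>" "\<bar>c u - c v\<bar> \<le> 2 * k - 1" by linarith+
  qed
  then show ?thesis by blast
qed

lemma circular_colouring_if_integer:
  fixes k p :: int
  assumes g: "is_graph G" and "k > 0" "p > 0" and c: "\<And>v. v \<in> verts G \<Longrightarrow> 0 \<le> c v \<and> c v < p"
    and edge: "\<And>u v. adj G u v \<Longrightarrow> k \<le> \<bar>c u - c v\<bar> \<and> \<bar>c u - c v\<bar> \<le> p - k"
  shows "circular_colouring (p / k) (\<lambda>v. circle_point (1 / (2 * pi)) (c v / p)) G"
  unfolding circular_colouring_def adj_def[symmetric]
proof (intro conjI allI impI image_subsetI)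
  show "circle_point (1 / (2 * pi)) (c v / p) \<in> sphere 0 (1 / (2 * pi))" for v
    by (rule circle_point_in_sphere) simp
  fix u v assume uv: "adj G u v"
  have pos: "position (1 / (2 * pi)) (circle_point (1 / (2 * pi)) (c v / p)) = c v / p" if "v \<in> verts G" for v
    using c[OF that] assms(3) by (intro position_circle_point) auto
  have arc: "arc_length (circle_point (1 / (2 * pi)) (c u / p)) (circle_point (1 / (2 * pi)) (c v / p))
      = arc_distance 1 (c u / p) (c v / p)" if "u \<in> verts G" "v \<in> verts G" for u v
    using arc_length_position[of "1 / (2 * pi)", OF _ circle_point_in_sphere circle_point_in_sphere] that
    by (simp add: pos)
  have "1 / (p / k) = real_of_int k / p" by simp
  moreover have "real_of_int k / p \<le> arc_distance 1 (c u / p) (c v / p)" if "adj G u v" for u v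
  proof -
    have "real_of_int k \<le> (if c u \<le> c v then real_of_int (c v - c u) else real_of_int (c v - c u + p))"
      using edge[OF that] by auto
    then have "real_of_int k / p \<le> (if c u \<le> c v then real_of_int (c v - c u) else real_of_int (c v - c u + p)) / p"
      using assms(3) by (intro divide_right_mono) auto
    also have "\<dots> = arc_distance 1 (c u / p) (c v / p)"
      using assms(3) by (auto simp: arc_distance_def divide_le_cancel field_simps)
    finally show ?thesis .
  qed
  ultimately show "1 / (p / k) \<le> arc_length (circle_point (1 / (2 * pi)) (c u / p)) (circle_point (1 / (2 * pi)) (c v / p))"
    "1 / (p / k) \<le> arc_length (circle_point (1 / (2 * pi)) (c v / p)) (circle_point (1 / (2 * pi)) (c u / p))"
    using uv adj_swap[OF uv] adjD[OF g uv] by (simp_all add: arc)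
qed

proposition circular_chromatic_number_less_3_iff:
  assumes G: "finite_graph G"
  shows "\<chi>\<^sub>c G < 3 \<longleftrightarrow> (\<exists>k c. andrasfai_colouring k c G)"
proof
  have g: "is_graph G" and fin: "finite (verts G)" and ne: "verts G \<noteq> {}"
    using G by (auto simp: finite_graph_def is_graph_def)
  let ?S = "{r. r > 0 \<and> (\<exists>f. circular_colouring r f G)}"
  show "\<exists>k c. andrasfai_colouring k c G" if less: "\<chi>\<^sub>c G < 3"
  proof -
    \<comment> \<open>Spreading the vertices evenly shows that the infimum is over a nonempty set, and so it is approached.\<close>
    obtain h where h: "bij_betw h (verts G) {0..<card (verts G)}"
      using ex_bij_betw_finite_nat[OF fin] by blast
    have "circular_colouring (real_of_int (int (card (verts G))) / real_of_int 1)
      (\<lambda>v. circle_point (1 / (2 * pi)) (real_of_int (int (h v)) / real_of_int (int (card (verts G))))) G"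
    proof (rule circular_colouring_if_integer[OF g])
      show "0 \<le> int (h v) \<and> int (h v) < int (card (verts G))" if "v \<in> verts G" for v
        using bij_betwE[OF h] that by simp
      fix u v assume "adj G u v"
      from adjD[OF g this] have "h u \<noteq> h v" "h u < card (verts G)" "h v < card (verts G)"
        using h by (auto simp: bij_betw_def inj_on_def)
      then show "1 \<le> \<bar>int (h u) - int (h v)\<bar> \<and> \<bar>int (h u) - int (h v)\<bar> \<le> int (card (verts G)) - 1"
        by auto
    qed (use fin ne in \<open>auto simp: card_gt_0_iff\<close>)
    then have "real (card (verts G)) \<in> ?S" using fin ne by (auto simp: card_gt_0_iff)
    then obtain r f where r: "0 < r" "r < 3" and f: "circular_colouring r f G"
      using less cInf_lessD[of ?S 3] unfolding circular_chromatic_number_def by blast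
    define t where "t v = position (1 / (2 * pi)) (f v)" for v
    have t: "0 \<le> t v" "t v < 1" for v
      using position_range[of "1 / (2 * pi)" "f v"] by (auto simp: t_def)
    have "1 / 3 < \<bar>t u - t v\<bar> \<and> \<bar>t u - t v\<bar> < 2 / 3" if uv: "adj G u v" for u v
    proof -
      have "f u \<in> sphere 0 (1 / (2 * pi))" "f v \<in> sphere 0 (1 / (2 * pi))"
        using f adjD[OF g uv] by (auto simp: circular_colouring_def)
      then have "arc_length (f u) (f v) = arc_distance 1 (t u) (t v)" "arc_length (f v) (f u) = arc_distance 1 (t v) (t u)"
        by (simp_all add: arc_length_position[of "1 / (2 * pi)"] t_def)
      moreover have "1 / r \<le> arc_length (f u) (f v)" "1 / r \<le> arc_length (f v) (f u)"
        using f uv by (auto simp: circular_colouring_def adj_def)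
      moreover have "1 / 3 < 1 / r" using r by (simp add: frac_less2)
      ultimately show ?thesis
        using arc_distance_gt_iff[of "1 / 3" "t u" 1 "t v"] t by auto
    qed
    with t show ?thesis by (intro andrasfai_colouring_if_angles[OF G, of t]) auto
  qed
  show "\<chi>\<^sub>c G < 3" if "\<exists>k c. andrasfai_colouring k c G"
  proof -
    from that obtain k c where c: "andrasfai_colouring k c G" by blast
    then have k: "k \<ge> 1" by (simp add: andrasfai_colouring_def)
    have "circular_colouring ((3 * k - 1) / k) (\<lambda>v. circle_point (1 / (2 * pi)) (c v / (3 * k - 1))) G"
      using circular_colouring_if_integer[OF g, of k "3 * k - 1" c] c k by (simp add: andrasfai_colouring_def)
    moreover have "(3 * real_of_int k - 1) / k > 0" using k by simp
    ultimately have "(3 * real_of_int k - 1) / k \<in> ?S" by auto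
    then have "\<chi>\<^sub>c G \<le> (3 * real_of_int k - 1) / k"
      unfolding circular_chromatic_number_def by (intro cInf_lower) (auto intro: bdd_belowI[of _ 0])
    also have "\<dots> < 3" using k by (simp add: divide_less_eq)
    finally show ?thesis .
  qed
qed

section \<open>The dense graph on the circle\<close>

lemma cos_le_cos_iff:
  assumes "0 \<le> \<alpha>" "\<alpha> \<le> pi" "0 \<le> t" "t \<le> 2 * pi"
  shows "cos t \<le> cos \<alpha> \<longleftrightarrow> \<alpha> \<le> t \<and> t \<le> 2 * pi - \<alpha>"
proof (cases "t \<le> pi")
  case True then show ?thesis using assms cos_mono_le_eq[of t \<alpha>] by auto
next
  case False
  have "cos t = cos (2 * pi - t)" by (simp add: cos_diff)
  with False show ?thesis using assms cos_mono_le_eq[of "2 * pi - t" \<alpha>] by auto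
qed

lemma cos_less_cos_iff:
  assumes "0 \<le> \<alpha>" "\<alpha> \<le> pi" "0 \<le> t" "t \<le> 2 * pi"
  shows "cos t < cos \<alpha> \<longleftrightarrow> \<alpha> < t \<and> t < 2 * pi - \<alpha>"
proof (cases "t \<le> pi")
  case True then show ?thesis using assms cos_mono_less_eq[of t \<alpha>] by auto
next
  case False
  have "cos t = cos (2 * pi - t)" by (simp add: cos_diff)
  with False show ?thesis using assms cos_mono_less_eq[of "2 * pi - t" \<alpha>] by auto
qed

lemma adj_C3_graph:
  assumes D: "D \<subseteq> sphere 0 1"
  shows "adj (C3_graph D) x y \<longleftrightarrow> x \<in> D \<and> y \<in> D \<and> 2 * pi / 3 < \<bar>Arg2pi x - Arg2pi y\<bar> \<and>
    \<bar>Arg2pi x - Arg2pi y\<bar> < 2 * pi - 2 * pi / 3"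
proof -
  have "adj (C3_graph D) x y \<longleftrightarrow> x \<in> D \<and> y \<in> D \<and> arc_length x y > 2 * pi / 3 \<and> arc_length y x > 2 * pi / 3"
    by (auto simp: adj_def C3_graph_def doubleton_eq_iff)
  moreover have "arc_length x y = arc_distance (2 * pi) (Arg2pi x) (Arg2pi y)" if "x \<in> D" "y \<in> D" for x y
    using arc_length_position[of 1 x y] subsetD[OF D that(1)] subsetD[OF D that(2)]
    by (simp add: position_def)
  ultimately show ?thesis
    using arc_distance_gt_iff[of "2 * pi / 3" "Arg2pi x" "2 * pi" "Arg2pi y"]
      Arg2pi_ge_0[of x] Arg2pi_lt_2pi[of x] Arg2pi_ge_0[of y] Arg2pi_lt_2pi[of y] by auto
qed

text \<open>For points of the unit circle, \<open>Re (x * cnj y)\<close> is the cosine of the angle between them. In this form the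
  adjacency is visibly an open condition on the two points.\<close>

lemma adj_C3_graph_Re:
  assumes D: "D \<subseteq> sphere 0 1"
  shows "adj (C3_graph D) x y \<longleftrightarrow> x \<in> D \<and> y \<in> D \<and> Re (x * cnj y) < cos (2 * pi / 3)"
proof -
  have "Re (x * cnj y) = cos \<bar>Arg2pi x - Arg2pi y\<bar>" if "x \<in> D" "y \<in> D"
  proof -
    have "cmod x = 1" "cmod y = 1" using that D by auto
    then have "x = cis (Arg2pi x)" "y = cis (Arg2pi y)"
      using complex_norm_eq_1_exp by (metis cis_conv_exp)+
    then have "x * cnj y = cis (Arg2pi x - Arg2pi y)" by (metis cis_cnj cis_mult diff_conv_add_uminus)
    then show ?thesis by simp
  qed
  moreover have "cos \<bar>Arg2pi x - Arg2pi y\<bar> < cos (2 * pi / 3) \<longleftrightarrow>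
    2 * pi / 3 < \<bar>Arg2pi x - Arg2pi y\<bar> \<and> \<bar>Arg2pi x - Arg2pi y\<bar> < 2 * pi - 2 * pi / 3"
    using Arg2pi_ge_0[of x] Arg2pi_lt_2pi[of x] Arg2pi_ge_0[of y] Arg2pi_lt_2pi[of y]
    by (intro cos_less_cos_iff) auto
  ultimately show ?thesis unfolding adj_C3_graph[OF D] by auto
qed

text \<open>Adjacent colours of an Andrasfai colouring correspond to angles in \<open>{\<alpha>..2 * pi - \<alpha>}\<close> with
  \<open>\<alpha> = 2 * pi * k / (3 * k - 1) > 2 * pi / 3\<close>. The vertices of \<open>\<complex>\<^sub>3\<close> are dense in the circle, and replacing the
  equidistant points by close enough vertices of \<open>\<complex>\<^sub>3\<close> keeps the angles larger than \<open>2 * pi / 3\<close>.\<close>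

proposition CSP_C3_iff:
  assumes G: "finite_graph G" and D: "C3_points D"
  shows "G \<in> CSP (C3_graph D) \<longleftrightarrow> (\<exists>k c. andrasfai_colouring k c G)"
proof
  have g: "is_graph G" using G by (auto simp: finite_graph_def)
  have D1: "D \<subseteq> sphere 0 1" and dense: "sphere 0 1 \<subseteq> closure D" using D by (auto simp: C3_points_def)
  show "\<exists>k c. andrasfai_colouring k c G" if "G \<in> CSP (C3_graph D)"
  proof -
    from that obtain f where f: "\<And>u v. adj G u v \<Longrightarrow> adj (C3_graph D) (f u) (f v)"
      by (auto simp: CSP_def homomorphism_def adj_def)
    define t where "t v = Arg2pi (f v) / (2 * pi)" for v
    have "0 \<le> t v \<and> t v < 1" for v
      using Arg2pi_ge_0[of "f v"] Arg2pi_lt_2pi[of "f v"] by (auto simp: t_def)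
    moreover have "1 / 3 < \<bar>t u - t v\<bar> \<and> \<bar>t u - t v\<bar> < 2 / 3" if "adj G u v" for u v
    proof -
      have "t u - t v = (Arg2pi (f u) - Arg2pi (f v)) / (2 * pi)" by (simp add: t_def diff_divide_distrib)
      then have A: "\<bar>Arg2pi (f u) - Arg2pi (f v)\<bar> = 2 * pi * \<bar>t u - t v\<bar>" by simp
      have "2 * pi * (1 / 3) < 2 * pi * \<bar>t u - t v\<bar>" "2 * pi * \<bar>t u - t v\<bar> < 2 * pi * (2 / 3)"
        using f[OF that] unfolding adj_C3_graph[OF D1] A by auto
      moreover have "2 * pi * a < 2 * pi * b \<longleftrightarrow> a < b" for a b :: real by simp
      ultimately show ?thesis by blast
    qed
    ultimately show ?thesis by (rule andrasfai_colouring_if_angles[OF G])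
  qed
  show "G \<in> CSP (C3_graph D)" if "\<exists>k c. andrasfai_colouring k c G"
  proof -
    from that obtain k c where c: "andrasfai_colouring k c G" by blast
    then have k: "k \<ge> 1" by (simp add: andrasfai_colouring_def)
    define P where "P = 3 * real_of_int k - 1"
    have P: "P > 0" using k by (simp add: P_def)
    define \<alpha> where "\<alpha> = 2 * pi * k / P"
    have \<alpha>: "2 * pi / 3 < \<alpha>" "\<alpha> \<le> pi" "2 * pi - \<alpha> = 2 * pi * (2 * k - 1) / P"
      using k P by (auto simp: \<alpha>_def P_def field_simps)
    define z where "z i = cis (2 * pi * real_of_int i / P)" for i
    \<comment> \<open>Moving both points by less than \<open>\<delta>\<close> changes the cosine of their angle by less than \<open>2 * \<delta>\<close>.\<close>
    define \<delta> where "\<delta> = (cos (2 * pi / 3) - cos \<alpha>) / 2"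
    have "\<delta> > 0" using cos_mono_less_eq[of \<alpha> "2 * pi / 3"] \<alpha> by (auto simp: \<delta>_def)
    have "\<exists>d\<in>D. dist d (z i) < \<delta>" for i
    proof -
      have "z i \<in> sphere 0 1" by (simp add: z_def)
      with dense have "z i \<in> closure D" by blast
      then show ?thesis using \<open>\<delta> > 0\<close> closure_approachable by blast
    qed
    then obtain d where d: "\<And>i. d i \<in> D" "\<And>i. cmod (d i - z i) < \<delta>"
      unfolding dist_norm by metis
    have "adj (C3_graph D) (d (c u)) (d (c v))" if uv: "adj G u v" for u v
    proof -
      let ?i = "c u" and ?j = "c v"
      have ij: "k \<le> \<bar>?i - ?j\<bar>" "\<bar>?i - ?j\<bar> \<le> 2 * k - 1"
        using c uv by (auto simp: andrasfai_colouring_def)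
      have "z ?i * cnj (z ?j) = cis (2 * pi * real_of_int ?i / P - 2 * pi * real_of_int ?j / P)"
        unfolding z_def by (simp add: cis_cnj cis_mult)
      then have "Re (z ?i * cnj (z ?j)) = cos (2 * pi * real_of_int ?i / P - 2 * pi * real_of_int ?j / P)"
        by simp
      also have "\<dots> = cos \<bar>2 * pi * real_of_int ?i / P - 2 * pi * real_of_int ?j / P\<bar>" by simp
      also have "2 * pi * real_of_int ?i / P - 2 * pi * real_of_int ?j / P = 2 * pi * real_of_int (?i - ?j) / P"
        by (simp add: diff_divide_distrib algebra_simps)
      also have "\<bar>2 * pi * real_of_int (?i - ?j) / P\<bar> = 2 * pi * real_of_int \<bar>?i - ?j\<bar> / P"
        using P by (simp add: abs_mult)
      finally have "Re (z ?i * cnj (z ?j)) = cos (2 * pi * real_of_int \<bar>?i - ?j\<bar> / P)" .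
      moreover have "real_of_int k \<le> real_of_int \<bar>?i - ?j\<bar>" "real_of_int \<bar>?i - ?j\<bar> \<le> real_of_int (2 * k - 1)"
        using ij by (simp_all only: of_int_le_iff)
      then have "2 * pi * real_of_int k / P \<le> 2 * pi * real_of_int \<bar>?i - ?j\<bar> / P"
        "2 * pi * real_of_int \<bar>?i - ?j\<bar> / P \<le> 2 * pi * real_of_int (2 * k - 1) / P"
        using P by (intro divide_right_mono mult_left_mono; simp)+
      then have "\<alpha> \<le> 2 * pi * real_of_int \<bar>?i - ?j\<bar> / P"
        "2 * pi * real_of_int \<bar>?i - ?j\<bar> / P \<le> 2 * pi - \<alpha>"
        unfolding \<alpha>(3) by (simp_all add: \<alpha>_def)
      moreover have "0 \<le> \<alpha>" using \<alpha>(1) pi_gt_zero by linarith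
      ultimately have zz: "Re (z ?i * cnj (z ?j)) \<le> cos \<alpha>"
        using cos_le_cos_iff[of \<alpha> "2 * pi * real_of_int \<bar>?i - ?j\<bar> / P"] \<alpha> by linarith
      have "d ?i * cnj (d ?j) - z ?i * cnj (z ?j) = (d ?i - z ?i) * cnj (d ?j) + z ?i * cnj (d ?j - z ?j)"
        by (simp add: algebra_simps)
      also have "cmod \<dots> \<le> cmod (d ?i - z ?i) * cmod (d ?j) + cmod (z ?i) * cmod (d ?j - z ?j)"
        using norm_triangle_ineq by (metis complex_mod_cnj norm_mult)
      also have "\<dots> = cmod (d ?i - z ?i) + cmod (d ?j - z ?j)"
        using subsetD[OF D1 d(1)] by (simp add: z_def)
      also have "\<dots> < 2 * \<delta>" using d(2)[of ?i] d(2)[of ?j] by simp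
      finally have "cmod (d ?i * cnj (d ?j) - z ?i * cnj (z ?j)) < 2 * \<delta>" .
      then have "Re (d ?i * cnj (d ?j)) < Re (z ?i * cnj (z ?j)) + 2 * \<delta>"
        using abs_Re_le_cmod[of "d ?i * cnj (d ?j) - z ?i * cnj (z ?j)"] by simp
      also have "2 * \<delta> = cos (2 * pi / 3) - cos \<alpha>" by (simp add: \<delta>_def)
      also have "Re (z ?i * cnj (z ?j)) + (cos (2 * pi / 3) - cos \<alpha>) \<le> cos (2 * pi / 3)"
        using zz by linarith
      finally show ?thesis unfolding adj_C3_graph_Re[OF D1] using d(1) by simp
    qed
    then have "homomorphism (d \<circ> c) G (C3_graph D)"
      using d(1) by (auto simp: homomorphism_def adj_def C3_graph_def)
    with G show ?thesis by (auto simp: CSP_def)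
  qed
qed

section \<open>Unit arcs\<close>

lemma adj_intersection_graph:
  "adj (intersection_graph \<A>) a b \<longleftrightarrow> a \<in> \<A> \<and> b \<in> \<A> \<and> a \<noteq> b \<and> a \<inter> b \<noteq> {}"
  by (auto simp: adj_def intersection_graph_def doubleton_eq_iff Int_commute)

definition unit_arc :: "real \<Rightarrow> complex \<Rightarrow> complex set" where
  "unit_arc \<rho> x = {z \<in> sphere 0 \<rho>. arc_length x z \<le> 1}"

lemma unit_circular_arc_eq:
  assumes "x \<in> sphere 0 \<rho>" "arc_length x y = 1"
  shows "circular_arc x y = unit_arc \<rho> x"
  using assms by (simp add: circular_arc_def unit_arc_def)

lemma ex_unit_circular_arc:
  assumes \<rho>: "\<rho> > 0" "2 * pi * \<rho> > 1" and x: "x \<in> sphere 0 \<rho>"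
  shows "\<exists>y\<in>sphere 0 \<rho>. unit_arc \<rho> x = circular_arc x y \<and> arc_length x y = 1"
proof -
  have n: "cmod x = \<rho>" "x \<noteq> 0" using assms by auto
  let ?y = "x * cis (1 / \<rho>)"
  have "?y / x = cis (1 / \<rho>)" using n by simp
  moreover have "Arg2pi (cis (1 / \<rho>)) = 1 / \<rho>"
    by (rule Arg2pi_unique[of 1]) (use \<rho> in \<open>auto simp: cis_conv_exp field_simps\<close>)
  ultimately have "arc_length x ?y = 1" using n \<rho> by (simp add: arc_length_def)
  moreover have "?y \<in> sphere 0 \<rho>" using n by (simp add: norm_mult)
  ultimately show ?thesis using unit_circular_arc_eq[OF x] by metis
qed

text \<open>If the arcs meet in \<open>z\<close>, then the one of \<open>x\<close>, \<open>y\<close> that is passed last on the way to \<open>z\<close> lies on the arc that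
  starts at the other one.\<close>

lemma unit_arcs_disjoint_iff:
  assumes \<rho>: "\<rho> > 0" and x: "x \<in> sphere 0 \<rho>" and y: "y \<in> sphere 0 \<rho>"
  shows "unit_arc \<rho> x \<inter> unit_arc \<rho> y = {} \<longleftrightarrow> far_apart (2 * pi * \<rho>) (position \<rho> x) (position \<rho> y)"
proof -
  let ?L = "2 * pi * \<rho>"
  note arc = arc_length_position[OF \<rho>]
  have far: "far_apart ?L (position \<rho> x) (position \<rho> y) \<longleftrightarrow> 1 < arc_length x y \<and> 1 < arc_length y x"
    using arc_distance_gt_iff[of 1 "position \<rho> x" ?L "position \<rho> y"] position_range[OF \<rho>]
    by (simp add: far_apart_def arc[OF x y] arc[OF y x])
  have "x \<in> unit_arc \<rho> x" "y \<in> unit_arc \<rho> y"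
    using x y by (auto simp: unit_arc_def arc arc_distance_def)
  moreover have "x \<in> unit_arc \<rho> y \<longleftrightarrow> arc_length y x \<le> 1" "y \<in> unit_arc \<rho> x \<longleftrightarrow> arc_length x y \<le> 1"
    using x y by (auto simp: unit_arc_def)
  moreover have "arc_length x y \<le> 1 \<or> arc_length y x \<le> 1" if "z \<in> unit_arc \<rho> x" "z \<in> unit_arc \<rho> y" for z
  proof -
    from that have z: "z \<in> sphere 0 \<rho>" "arc_length x z \<le> 1" "arc_length y z \<le> 1"
      by (auto simp: unit_arc_def)
    show ?thesis
      using z(2,3) position_range[OF \<rho>, of x] position_range[OF \<rho>, of y] position_range[OF \<rho>, of z]
      unfolding arc[OF x y] arc[OF y x] arc[OF x z(1)] arc[OF y z(1)] arc_distance_def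
      by (smt (verit))
  qed
  ultimately show ?thesis unfolding far by (auto simp: not_less[symmetric])
qed

text \<open>On a circle longer than 3, being at most 1 ahead is a transitive relation on a set of pairwise close
  points, and so one of the points is at most 1 ahead of all of them. For unit arcs starting at these points
  this is the Helly property: the starting point found here lies on every arc.\<close>

lemma last_position:
  fixes L :: real
  assumes "finite I" "I \<noteq> {}" "L > 3" "\<And>i. i \<in> I \<Longrightarrow> 0 \<le> s i \<and> s i < L"
    and "\<And>i j. i \<in> I \<Longrightarrow> j \<in> I \<Longrightarrow> \<not> far_apart L (s i) (s j)"
  shows "\<exists>i\<in>I. \<forall>j\<in>I. arc_distance L (s j) (s i) \<le> 1"
  using assms(1,2,4,5)
proof (induction I rule: finite_ne_induct)
  case (singleton x)
  then show ?case by (simp add: arc_distance_def)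
next
  case (insert u I)
  then obtain i where i: "i \<in> I" "\<forall>j\<in>I. arc_distance L (s j) (s i) \<le> 1" by auto
  have "arc_distance L (s u) (s i) \<le> 1 \<or> arc_distance L (s i) (s u) \<le> 1"
    using insert.prems(1)[of u] insert.prems(1)[of i] insert.prems(2)[of u i] i(1)
    by (auto simp: arc_distance_def far_apart_def)
  then show ?case
  proof
    assume "arc_distance L (s u) (s i) \<le> 1"
    with i show ?thesis by auto
  next
    assume iu: "arc_distance L (s i) (s u) \<le> 1"
    have "arc_distance L (s j) (s u) \<le> 1" if "j \<in> I" for j
      using insert.prems(1)[of u] insert.prems(1)[of i] insert.prems(1)[of j] insert.prems(2)[of j u]
        i that iu assms(3)
      unfolding arc_distance_def far_apart_def by (smt (verit) insertCI)
    moreover have "arc_distance L (s u) (s u) \<le> 1" by (simp add: arc_distance_def)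
    ultimately show ?thesis by auto
  qed
qed

text \<open>Unit arcs starting at the positions \<open>c v / (k - 1 / 2)\<close> on a circle of length \<open>(3 * k - 1) / (k - 1 / 2) > 3\<close>
  are disjoint exactly if the colours are adjacent. A model is a set of arcs, and so vertices with the same
  colour need different arcs: the colours are first shifted by distinct amounts in \<open>{0..<1 / 2}\<close>, which
  does not change any of these adjacencies. Multiplication by \<open>2 * n\<close>, where \<open>n\<close> is the number of vertices,
  makes all these numbers integral.\<close>

proposition unit_Helly_if_andrasfai:
  assumes G: "finite_graph G" and c: "andrasfai_colouring k c G"
  shows "\<exists>H. spanning_subgraph H (complement G) \<and> free_of (edgeless_graph 3) H \<and>
    unit_Helly_circular_arc_graph H"
proof -
  have g: "is_graph G" and fin: "finite (verts G)" and ne: "verts G \<noteq> {}"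
    using G by (auto simp: finite_graph_def is_graph_def)
  have k: "k \<ge> 1" and range: "\<And>v. v \<in> verts G \<Longrightarrow> 0 \<le> c v \<and> c v < 3 * k - 1"
    using c by (auto simp: andrasfai_colouring_def)
  define n where "n = int (card (verts G))"
  have n: "n \<ge> 1" using fin ne by (simp add: n_def Suc_le_eq card_gt_0_iff)
  obtain h0 where h0: "bij_betw h0 (verts G) {0..<card (verts G)}"
    using ex_bij_betw_finite_nat[OF fin] by blast
  define h where "h v = int (h0 v)" for v
  have h: "0 \<le> h v" "h v < n" if "v \<in> verts G" for v
    using bij_betwE[OF h0] that by (auto simp: h_def n_def)
  have h_inj: "h u \<noteq> h v" if "u \<in> verts G" "v \<in> verts G" "u \<noteq> v" for u v
    using h0 that by (auto simp: h_def bij_betw_def inj_on_def)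
  \<comment> \<open>In units of \<open>1 / (2 * n)\<close>: \<open>m\<close> is the length of an arc, \<open>p\<close> that of the circle, \<open>i v\<close> the shifted colour of \<open>v\<close>.\<close>
  define m where "m = n * (2 * k - 1)"
  define p where "p = 2 * n * (3 * k - 1)"
  define i where "i v = 2 * n * c v + h v" for v
  have m: "m > 0" using n k by (simp add: m_def)
  have i_range: "0 \<le> i v" "i v < p" if "v \<in> verts G" for v
  proof -
    show "0 \<le> i v" using range[OF that] h[OF that] n by (simp add: i_def)
    have "n * (c v + 1) \<le> n * (3 * k - 1)" using range[OF that] n by (intro mult_left_mono) auto
    then show "i v < p" using h[OF that] n by (simp add: i_def p_def algebra_simps)
  qed
  have close: "m < \<bar>i u - i v\<bar> \<and> \<bar>i u - i v\<bar> < p - m \<longleftrightarrow> k \<le> \<bar>c u - c v\<bar> \<and> \<bar>c u - c v\<bar> \<le> 2 * k - 1"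
    if uv: "u \<in> verts G" "v \<in> verts G" for u v
  proof -
    have main: "m < i u - i v \<and> i u - i v < p - m \<longleftrightarrow> k \<le> c u - c v \<and> c u - c v \<le> 2 * k - 1"
      if "u \<in> verts G" "v \<in> verts G" for u v
    proof -
      define e where "e = h u - h v"
      have e: "- n < e" "e < n" using h[OF that(1)] h[OF that(2)] by (auto simp: e_def)
      define d where "d = c u - c v"
      have i: "i u - i v = 2 * (n * d) + e" by (simp add: i_def d_def e_def algebra_simps)
      have m': "m = 2 * (n * k) - n" by (simp add: m_def algebra_simps)
      have p': "p - m = 4 * (n * k) - n" by (simp add: p_def m_def algebra_simps)
      have "n * k \<le> n * d" if "k \<le> d" using that n by simp
      moreover have "n * d \<le> n * k - n" if "d < k"
        using mult_left_mono[of d "k - 1" n] that n by (simp add: algebra_simps)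
      moreover have "n * d \<le> 2 * (n * k) - n" if "d \<le> 2 * k - 1"
        using mult_left_mono[of d "2 * k - 1" n] that n by (simp add: algebra_simps)
      moreover have "2 * (n * k) \<le> n * d" if "d > 2 * k - 1"
        using mult_left_mono[of "2 * k" d n] that n by (simp add: algebra_simps)
      ultimately have "m < 2 * (n * d) + e \<longleftrightarrow> k \<le> d" "2 * (n * d) + e < p - m \<longleftrightarrow> d \<le> 2 * k - 1"
        using m' p' e by (smt (verit))+
      then show ?thesis unfolding i d_def by blast
    qed
    have less: "i u < i v" if "u \<in> verts G" "v \<in> verts G" "c u < c v" for u v
    proof -
      have "n * (c u + 1) \<le> n * c v" using that n by (intro mult_left_mono) auto
      then show ?thesis using h[OF that(1)] h[OF that(2)] n by (simp add: i_def algebra_simps)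
    qed
    consider "c u < c v" | "c v < c u" | "c u = c v" by linarith
    then show ?thesis
    proof cases
      case 1 then show ?thesis using main[OF uv(2,1)] less[OF uv] by auto
    next
      case 2 then show ?thesis using main[OF uv] less[OF uv(2,1)] by auto
    next
      case 3
      have "n * 1 \<le> m" unfolding m_def using n k by (intro mult_left_mono) auto
      moreover have "\<bar>i u - i v\<bar> < n" using 3 h[OF uv(1)] h[OF uv(2)] by (simp add: i_def)
      ultimately show ?thesis using 3 k by auto
    qed
  qed
  define L where "L = real_of_int p / m"
  have "3 * m < p" using n by (simp add: p_def m_def algebra_simps)
  then have "real_of_int (3 * m) < real_of_int p" by (simp only: of_int_less_iff)
  then have L: "L > 3" using m by (simp add: L_def less_divide_eq)
  define \<rho> where "\<rho> = L / (2 * pi)"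
  have \<rho>: "\<rho> > 0" and L\<rho>: "2 * pi * \<rho> = L" using L by (auto simp: \<rho>_def)
  define s where "s v = real_of_int (i v) / m" for v
  have s: "0 \<le> s v" "s v < L" if "v \<in> verts G" for v
    using i_range[OF that] m by (auto simp: s_def L_def divide_less_cancel)
  have far: "far_apart L (s u) (s v) \<longleftrightarrow> k \<le> \<bar>c u - c v\<bar> \<and> \<bar>c u - c v\<bar> \<le> 2 * k - 1"
    if "u \<in> verts G" "v \<in> verts G" for u v
    unfolding L_def s_def far_apart_scaled[OF m] by (rule close[OF that])
  have s_inj: "s u \<noteq> s v" if uv: "u \<in> verts G" "v \<in> verts G" "u \<noteq> v" for u v
  proof
    assume "s u = s v"
    then have eq: "2 * n * c u + h u = 2 * n * c v + h v" using m by (simp add: s_def i_def flip: of_int_add)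
    have "h w = (2 * n * c w + h w) mod (2 * n)" if "w \<in> verts G" for w
      using h[OF that] by simp
    then have "h u = h v" using eq uv by metis
    with h_inj[OF uv] show False by simp
  qed
  define x where "x v = circle_point \<rho> (s v)" for v
  have x: "x v \<in> sphere 0 \<rho>" for v unfolding x_def by (rule circle_point_in_sphere[OF \<rho>])
  have pos: "position \<rho> (x v) = s v" if "v \<in> verts G" for v
    unfolding x_def using s[OF that] by (intro position_circle_point[OF \<rho>]) (auto simp: L\<rho>)
  define a where "a v = unit_arc \<rho> (x v)" for v
  have disj: "a u \<inter> a v = {} \<longleftrightarrow> far_apart L (s u) (s v)" if "u \<in> verts G" "v \<in> verts G" for u v
    unfolding a_def unit_arcs_disjoint_iff[OF \<rho> x x] L\<rho> pos[OF that(1)] pos[OF that(2)] ..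
  have mem: "x u \<in> a v \<longleftrightarrow> arc_distance L (s v) (s u) \<le> 1" if "u \<in> verts G" "v \<in> verts G" for u v
    using x arc_length_position[OF \<rho> x x, of v u] pos that by (simp add: a_def unit_arc_def L\<rho>)
  have inj: "inj_on a (verts G)"
  proof (rule inj_onI, rule ccontr)
    fix u v assume uv: "u \<in> verts G" "v \<in> verts G" "a u = a v" "u \<noteq> v"
    have "arc_distance L (s u) (s u) \<le> 1" "arc_distance L (s v) (s v) \<le> 1" by (auto simp: arc_distance_def)
    then have "arc_distance L (s u) (s v) \<le> 1" "arc_distance L (s v) (s u) \<le> 1"
      using mem uv by metis+
    with s_inj[OF uv(1,2,4)] L show False by (auto simp: arc_distance_def split: if_splits)
  qed
  define H where "H = \<lparr>verts = verts G, edges = {{u, v} | u v. u \<in> verts G \<and> v \<in> verts G \<and> u \<noteq> v \<and> a u \<inter> a v \<noteq> {}}\<rparr>"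
  have VH: "verts H = verts G" by (simp add: H_def)
  have adjH: "adj H u v \<longleftrightarrow> u \<in> verts G \<and> v \<in> verts G \<and> u \<noteq> v \<and> a u \<inter> a v \<noteq> {}" for u v
    by (auto simp: adj_def H_def doubleton_eq_iff)
  have gH: "is_graph H" using ne by (auto simp: is_graph_def H_def)
  have "spanning_subgraph H (complement G)"
    unfolding spanning_subgraph_def subgraph_def
  proof (intro conjI gH)
    show "verts H \<subseteq> verts (complement G)" "verts H = verts (complement G)"
      by (auto simp: VH complement_def)
    show "edges H \<subseteq> edges (complement G)"
    proof
      fix e assume "e \<in> edges H"
      then obtain u v where e: "e = {u, v}" and uv: "u \<in> verts G" "v \<in> verts G" "u \<noteq> v" "a u \<inter> a v \<noteq> {}"
        by (auto simp: H_def)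
      then have "\<not> adj G u v"
        using c disj far by (auto simp: andrasfai_colouring_def)
      with e uv show "e \<in> edges (complement G)" by (auto simp: complement_def adj_def)
    qed
  qed
  moreover have "free_of (edgeless_graph 3) H"
    unfolding free_of_3K1_iff[OF gH] VH
  proof clarify
    fix u v w assume V: "u \<in> verts G" "v \<in> verts G" "w \<in> verts G"
      and "u \<noteq> v" "v \<noteq> w" "u \<noteq> w" "\<not> adj H u v" "\<not> adj H v w" "\<not> adj H u w"
    then have "k \<le> \<bar>c u - c v\<bar> \<and> \<bar>c u - c v\<bar> \<le> 2 * k - 1" "k \<le> \<bar>c v - c w\<bar> \<and> \<bar>c v - c w\<bar> \<le> 2 * k - 1"
      "k \<le> \<bar>c u - c w\<bar> \<and> \<bar>c u - c w\<bar> \<le> 2 * k - 1"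
      by (simp_all add: adjH disj far)
    then show False using k by (smt (verit))
  qed
  moreover have "unit_Helly_circular_arc_graph H"
    unfolding unit_Helly_circular_arc_graph_def
  proof (intro exI conjI)
    have arcs: "\<exists>y\<in>sphere 0 \<rho>. unit_arc \<rho> (x v) = circular_arc (x v) y \<and> arc_length (x v) y = 1" for v
      using L by (intro ex_unit_circular_arc[OF \<rho> _ x]) (simp add: L\<rho>)
    show "unit_model \<rho> (a ` verts G)"
      unfolding unit_model_def a_def using arcs x by blast
    show "circular_arc_model \<rho> (a ` verts G) H"
      unfolding circular_arc_model_def
    proof (intro conjI \<rho>)
      show "\<forall>b\<in>a ` verts G. \<exists>x\<in>sphere 0 \<rho>. \<exists>y\<in>sphere 0 \<rho>. b = circular_arc x y"
        unfolding a_def using arcs x by blast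
      have "isomorphic H (intersection_graph (a ` verts G))"
        unfolding isomorphic_iff
      proof (intro exI[of _ a] conjI ballI)
        show "bij_betw a (verts H) (verts (intersection_graph (a ` verts G)))"
          using inj by (simp add: VH intersection_graph_def bij_betw_def)
        fix u v assume "u \<in> verts H" "v \<in> verts H"
        then show "adj H u v \<longleftrightarrow> adj (intersection_graph (a ` verts G)) (a u) (a v)"
          unfolding adjH VH adj_intersection_graph using inj by (auto simp: inj_on_eq_iff)
      qed
      then show "isomorphic (intersection_graph (a ` verts G)) H" using isomorphic_commute by blast
    qed
    show "Helly (a ` verts G)"
      unfolding Helly_def
    proof (intro allI impI)
      fix \<B> assume B: "\<B> \<subseteq> a ` verts G" "\<B> \<noteq> {} \<and> (\<forall>a\<in>\<B>. \<forall>b\<in>\<B>. a \<inter> b \<noteq> {})"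
      then obtain I where I: "I \<subseteq> verts G" "\<B> = a ` I" by (meson subset_imageE)
      have "\<exists>i\<in>I. \<forall>j\<in>I. arc_distance L (s j) (s i) \<le> 1"
      proof (rule last_position[OF _ _ L])
        show "finite I" using I fin by (auto intro: finite_subset)
        show "I \<noteq> {}" using B I by auto
        show "0 \<le> s i \<and> s i < L" if "i \<in> I" for i using s I that by blast
        show "\<not> far_apart L (s i) (s j)" if "i \<in> I" "j \<in> I" for i j
          using B I that disj[of i j] by blast
      qed
      then obtain w where "w \<in> I" "\<forall>j\<in>I. arc_distance L (s j) (s w) \<le> 1" by blast
      then have "x w \<in> \<Inter>\<B>" using mem I by blast
      then show "\<Inter>\<B> \<noteq> {}" by blast
    qed
  qed
  ultimately show ?thesis by blast
qed

lemma andrasfai_colouring_subgraph: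
  assumes "andrasfai_colouring k c G'" "verts G' = verts G" "edges G \<subseteq> edges G'"
  shows "andrasfai_colouring k c G"
  using assms by (auto simp: andrasfai_colouring_def adj_def)

text \<open>Non-adjacent vertices of \<open>H\<close>, and hence adjacent vertices of \<open>G\<close>, belong to disjoint arcs. On a circle of
  length at most 3 the starting points of disjoint arcs are more than a third of the circle apart. On a longer
  circle the disjointness graph of the arcs is an extension of \<open>G\<close> without the forbidden induced subgraphs.\<close>

proposition andrasfai_if_unit_Helly:
  assumes G: "finite_graph G" and H: "spanning_subgraph H (complement G)"
    and free: "free_of (edgeless_graph 3) H" and model: "unit_Helly_circular_arc_graph H"
  shows "\<exists>k c. andrasfai_colouring k c G"
proof -
  have g: "is_graph G" and fin: "finite (verts G)" and ne: "verts G \<noteq> {}"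
    using G by (auto simp: finite_graph_def is_graph_def)
  have gH: "is_graph H" and VH: "verts H = verts G" and EH: "edges H \<subseteq> edges (complement G)"
    using H by (auto simp: spanning_subgraph_def subgraph_def complement_def)
  obtain \<rho> \<A> where \<rho>: "\<rho> > 0" and iso: "isomorphic H (intersection_graph \<A>)" and unit: "unit_model \<rho> \<A>"
    using model isomorphic_commute unfolding unit_Helly_circular_arc_graph_def circular_arc_model_def by blast
  from iso obtain a where a: "bij_betw a (verts G) \<A>"
    and adj_a: "\<And>u v. u \<in> verts G \<Longrightarrow> v \<in> verts G \<Longrightarrow> adj H u v \<longleftrightarrow> adj (intersection_graph \<A>) (a u) (a v)"
    unfolding isomorphic_iff VH by (auto simp: intersection_graph_def)
  have "\<exists>x\<in>sphere 0 \<rho>. a v = unit_arc \<rho> x" if "v \<in> verts G" for v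
    using unit bij_betwE[OF a] that unit_circular_arc_eq unfolding unit_model_def by metis
  then obtain x where x: "\<And>v. v \<in> verts G \<Longrightarrow> x v \<in> sphere 0 \<rho>" "\<And>v. v \<in> verts G \<Longrightarrow> a v = unit_arc \<rho> (x v)"
    by metis
  define L where "L = 2 * pi * \<rho>"
  define s where "s v = position \<rho> (x v)" for v
  have L: "L > 0" using \<rho> by (simp add: L_def)
  have s: "0 \<le> s v \<and> s v < L" for v using position_range[OF \<rho>] by (simp add: s_def L_def)
  have far: "far_apart L (s u) (s v)"
    if uv: "u \<in> verts G" "v \<in> verts G" "u \<noteq> v" "\<not> adj H u v" for u v
  proof -
    have "a u \<in> \<A>" "a v \<in> \<A>" "a u \<noteq> a v" using a uv by (auto simp: bij_betw_def inj_on_def)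
    then have "a u \<inter> a v = {}"
      using adj_a[OF uv(1,2)] uv(4) by (auto simp: adj_intersection_graph)
    then show ?thesis
      using unit_arcs_disjoint_iff[OF \<rho> x(1)[OF uv(1)] x(1)[OF uv(2)]] uv
      by (simp add: x(2) L_def s_def)
  qed
  have "\<not> adj H u v" if "adj G u v" for u v
  proof
    assume "adj H u v"
    with EH have "{u, v} \<in> edges (complement G)" by (auto simp: adj_def)
    then obtain u' v' where "{u, v} = {u', v'}" "\<not> adj G u' v'" by (auto simp: complement_def adj_def)
    with that show False by (auto simp: adj_def)
  qed
  then have edge: "far_apart L (s u) (s v)" if "adj G u v" for u v
    using far that adjD[OF g that] by blast
  show ?thesis
  proof (cases "L \<le> 3")
    case True
    have "1 / 3 < \<bar>s u / L - s v / L\<bar> \<and> \<bar>s u / L - s v / L\<bar> < 2 / 3" if "adj G u v" for u v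
    proof -
      have e: "\<bar>s u / L - s v / L\<bar> = \<bar>s u - s v\<bar> / L" using L by (simp add: diff_divide_distrib[symmetric])
      have "1 < \<bar>s u - s v\<bar>" "\<bar>s u - s v\<bar> < L - 1" using edge[OF that] by (auto simp: far_apart_def)
      then show ?thesis unfolding e using True L by (simp add: field_simps)
    qed
    then show ?thesis using s L by (intro andrasfai_colouring_if_angles[OF G, of "\<lambda>v. s v / L"]) auto
  next
    case False
    define G' where "G' = circle_graph (verts G) L s"
    have g': "is_graph G'" and V': "verts G' = verts G"
      using is_graph_circle_graph[OF ne] by (auto simp: G'_def verts_circle_graph)
    have adj': "adj G' u v \<longleftrightarrow> u \<in> verts G \<and> v \<in> verts G \<and> far_apart L (s u) (s v)" for u v
      by (simp add: G'_def adj_circle_graph)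
    have "free_of K\<^sub>3 G'"
      unfolding free_of_K3_iff[OF g'] adj'
    proof clarify
      fix u v w assume V: "u \<in> verts G" "v \<in> verts G" "w \<in> verts G"
        and f: "far_apart L (s u) (s v)" "far_apart L (s v) (s w)" "far_apart L (s u) (s w)"
      have "\<not> adj H y z" if yz: "y \<in> verts G" "z \<in> verts G" "far_apart L (s y) (s z)" for y z
      proof -
        have "a y \<inter> a z = {}"
          using unit_arcs_disjoint_iff[OF \<rho> x(1)[OF yz(1)] x(1)[OF yz(2)]] yz
          by (simp add: x(2) L_def s_def)
        then show ?thesis
          using adj_a[OF yz(1,2)] by (auto simp: adj_intersection_graph)
      qed
      then have "\<not> adj H u v" "\<not> adj H v w" "\<not> adj H u w" using V f by auto
      moreover have "u \<noteq> v" "v \<noteq> w" "u \<noteq> w" using f by (auto simp: far_apart_def)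
      ultimately show False using free V unfolding free_of_3K1_iff[OF gH] VH by blast
    qed
    moreover have "finite_graph G'" using g' V' fin by (simp add: finite_graph_def)
    moreover have "free_of K1_plus_2K2 G'" "free_of K1_plus_C5 G'" "free_of C\<^sub>6 G'"
      using circle_graph_free[OF ne, of L s] False s by (simp_all add: G'_def)
    ultimately obtain k c where "andrasfai_colouring k c G'"
      using andrasfai_colouring_if_free by blast
    moreover have "edges G \<subseteq> edges G'"
    proof
      fix e assume e: "e \<in> edges G"
      with g obtain u v where uv: "u \<in> verts G" "v \<in> verts G" "e = {u, v}" unfolding is_graph_def by blast
      with e edge have "adj G' u v" by (simp add: adj_def[of G] adj')
      with uv show "e \<in> edges G'" by (simp add: adj_def)
    qed
    ultimately show ?thesis using andrasfai_colouring_subgraph V' by blast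
  qed
qed

section \<open>The equivalences\<close>

theorem theorem21:
  fixes G :: "'a graph" and D :: "complex set"
  assumes "finite_graph G"
    and "C3_points D"
  shows
    "(\<chi>\<^sub>c G < 3 \<longleftrightarrow> G \<in> CSP (C3_graph D)) \<and>
     (\<chi>\<^sub>c G < 3 \<longleftrightarrow>
        (\<exists>G'. extends_to G G' \<and> free_of K\<^sub>3 G' \<and> free_of K1_plus_2K2 G' \<and>
              free_of K1_plus_C5 G' \<and> free_of C\<^sub>6 G')) \<and>
     (\<chi>\<^sub>c G < 3 \<longleftrightarrow>
        (\<exists>G'. extends_to G G' \<and> maximal_triangle_free G' \<and> free_of K1_plus_2K2 G' \<and>
              free_of K1_plus_C5 G' \<and> free_of C\<^sub>6 G')) \<and>
     (\<chi>\<^sub>c G < 3 \<longleftrightarrow>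
        (\<exists>G'. extends_to G G' \<and> maximal_triangle_free G' \<and>
              \<not> contains_subgraph G' petersen_minus_vertex)) \<and>
     (\<chi>\<^sub>c G < 3 \<longleftrightarrow>
        (\<exists>H. spanning_subgraph H (complement G) \<and> free_of (edgeless_graph 3) H \<and>
             unit_Helly_circular_arc_graph H))"
proof -
  define A where "A \<longleftrightarrow> (\<exists>k c. andrasfai_colouring k c G)"
  note 1 = circular_chromatic_number_less_3_iff[OF assms(1), folded A_def]
  have up: "\<exists>G'. extends_to G G' \<and> maximal_triangle_free G' \<and> free_of C\<^sub>6 G'" if A
    using that maximal_extension_if_andrasfai[OF assms(1)] by (auto simp: A_def)
  have down: A if ext: "extends_to G G'"
    and free: "free_of K\<^sub>3 G'" "free_of K1_plus_2K2 G'" "free_of K1_plus_C5 G'" "free_of C\<^sub>6 G'" for G'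
  proof -
    have "finite_graph G'" using ext assms(1) by (simp add: extends_to_def finite_graph_def)
    then obtain k c where "andrasfai_colouring k c G'"
      using andrasfai_colouring_if_free[OF _ free] by blast
    then show A using andrasfai_colouring_subgraph ext unfolding A_def extends_to_def by metis
  qed
  have max: "free_of K\<^sub>3 G'" "free_of C\<^sub>6 G' \<Longrightarrow> free_of K1_plus_2K2 G'"
    "free_of C\<^sub>6 G' \<Longrightarrow> free_of K1_plus_C5 G'"
    "contains_subgraph G' petersen_minus_vertex \<longleftrightarrow> \<not> free_of C\<^sub>6 G'"
    if "maximal_triangle_free G'" for G' :: "'a graph"
    using that free_if_maximal_triangle_free[OF that] contains_petersen_minus_vertex_iff[OF that]
    by (auto simp: maximal_triangle_free_iff)
  show ?thesis
    unfolding 1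
  proof (intro conjI)
    show "A \<longleftrightarrow> G \<in> CSP (C3_graph D)"
      using CSP_C3_iff[OF assms] by (simp add: A_def)
    show "A \<longleftrightarrow> (\<exists>G'. extends_to G G' \<and> free_of K\<^sub>3 G' \<and> free_of K1_plus_2K2 G' \<and>
              free_of K1_plus_C5 G' \<and> free_of C\<^sub>6 G')"
      using up down max by blast
    show "A \<longleftrightarrow> (\<exists>G'. extends_to G G' \<and> maximal_triangle_free G' \<and> free_of K1_plus_2K2 G' \<and>
              free_of K1_plus_C5 G' \<and> free_of C\<^sub>6 G')"
      using up down max by blast
    show "A \<longleftrightarrow> (\<exists>G'. extends_to G G' \<and> maximal_triangle_free G' \<and>
              \<not> contains_subgraph G' petersen_minus_vertex)"
      using up down max by metis
    show "A \<longleftrightarrow> (\<exists>H. spanning_subgraph H (complement G) \<and> free_of (edgeless_graph 3) H \<and>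
             unit_Helly_circular_arc_graph H)"
      using unit_Helly_if_andrasfai[OF assms(1)] andrasfai_if_unit_Helly[OF assms(1)]
      unfolding A_def by blast
  qed
qed

end
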